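(* Let $Z$ be a Banach space and let $M,N$ be closed subspaces of $Z$. The following assertions are equivalent: (1) $(M,N)\in\mathcal{W}_-$ (the pair $(M,N)$ is cotauberian); (2) $(N^\perp,M^\perp)\in\mathcal{W}_+$ (the pair $(N^\perp,M^\perp)$ of closed subspaces of $Z^*$ is tauberian); (3) the operator $Q_{N^{co}}J_{M^{co}}\colon M^{co}\to Z^{co}/N^{co}$ has dense range; i.e. $M^{co}+N^{co}$ is dense in $Z^{co}$.
   Context: For a closed subspace $A$ of a Banach space $V$, $J_A\colon A\to V$ is the inclusion, $Q_A\colon V\to V/A$ the quotient map, and $A^\perp\subset V^*$ the annihilator. A Banach space $X$ is identified with its canonical image in $X^{**}$. A bounded operator $S\colon X\to Y$ between Banach spaces is tauberian if $S^{**}(X^{**}\setminus X)\subset Y^{**}\setminus Y$, and cotauberian if its conjugate $S^*\colon Y^*\to X^*$ is tauberian. A pair $(A,B)$ of closed subspaces of a Banach space $V$ is tauberian, $(A,B)\in\mathcal{W}_+$ (respectively cotauberian, $(A,B)\in\mathcal{W}_-$) if the operator $Q_BJ_A\colon A\to V/B$ is tauberian (respectively cotauberian). Put $Z^{co}=Z^{**}/Z$, and for a closed subspace $M$ of $Z$ let $M^{co}$ denote the closed subspace $(M^{\perp\perp}+Z)/Z$ of $Z^{co}$, where $M^{\perp\perp}\subset Z^{**}$ is the annihilator of $M^\perp$. *)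

theory Defs
  imports "HOL-Analysis.Abstract_Metric_Spaces" "HOL-Library.FuncSet"
begin

text \<open>
  Closed subspaces, quotients and duals of them occur here as Banach spaces in their own right,
  so normed spaces are given by explicit carriers rather than by the class \<open>banach\<close>.
\<close>

text \<open>
  Up to isometric isomorphism, the members of this class are exactly the real and the complex field
  with the usual absolute value.
\<close>

class rc_field = real_normed_field +
  assumes real_or_complex:
    "(\<forall>x. \<exists>a. x = a *\<^sub>R 1) \<or>
     (\<exists>i. i * i = - 1 \<and>
        (\<forall>x. \<exists>a b. x = a *\<^sub>R 1 + b *\<^sub>R i \<and> norm x = sqrt (a\<^sup>2 + b\<^sup>2)))"

instance real :: rc_field
  by standard auto

instance complex :: rc_field
proof
  have "x = Re x *\<^sub>R 1 + Im x *\<^sub>R \<i> \<and> norm x = sqrt ((Re x)\<^sup>2 + (Im x)\<^sup>2)" for x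
    by (simp add: cmod_def complex_eq_iff)
  then show "(\<forall>x::complex. \<exists>a. x = a *\<^sub>R 1) \<or>
     (\<exists>i::complex. i * i = - 1 \<and>
        (\<forall>x. \<exists>a b. x = a *\<^sub>R 1 + b *\<^sub>R i \<and> norm x = sqrt (a\<^sup>2 + b\<^sup>2)))"
    by (metis i_squared)
qed


subsection \<open>Normed spaces, subspaces, operators\<close>

record ('k, 'a) nspace =
  carr :: "'a set"
  vadd :: "'a \<Rightarrow> 'a \<Rightarrow> 'a"
  vzero :: "'a"
  vscale :: "'k \<Rightarrow> 'a \<Rightarrow> 'a"
  vnorm :: "'a \<Rightarrow> real"

locale normed_space =
  fixes X :: "('k::real_normed_field, 'a) nspace"
  assumes zero_closed: "vzero X \<in> carr X"
    and add_closed: "\<lbrakk>x \<in> carr X; y \<in> carr X\<rbrakk> \<Longrightarrow> vadd X x y \<in> carr X"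
    and scale_closed: "x \<in> carr X \<Longrightarrow> vscale X c x \<in> carr X"
    and add_assoc: "\<lbrakk>x \<in> carr X; y \<in> carr X; z \<in> carr X\<rbrakk> \<Longrightarrow>
          vadd X (vadd X x y) z = vadd X x (vadd X y z)"
    and add_commute: "\<lbrakk>x \<in> carr X; y \<in> carr X\<rbrakk> \<Longrightarrow> vadd X x y = vadd X y x"
    and add_zero: "x \<in> carr X \<Longrightarrow> vadd X x (vzero X) = x"
    and add_inverse: "x \<in> carr X \<Longrightarrow> \<exists>y\<in>carr X. vadd X x y = vzero X"
    and scale_add_right: "\<lbrakk>x \<in> carr X; y \<in> carr X\<rbrakk> \<Longrightarrow>
          vscale X c (vadd X x y) = vadd X (vscale X c x) (vscale X c y)"
    and scale_add_left: "x \<in> carr X \<Longrightarrow>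
          vscale X (c + d) x = vadd X (vscale X c x) (vscale X d x)"
    and scale_scale: "x \<in> carr X \<Longrightarrow> vscale X c (vscale X d x) = vscale X (c * d) x"
    and scale_one: "x \<in> carr X \<Longrightarrow> vscale X 1 x = x"
    and norm_eq_zero: "x \<in> carr X \<Longrightarrow> vnorm X x = 0 \<longleftrightarrow> x = vzero X"
    and norm_triangle: "\<lbrakk>x \<in> carr X; y \<in> carr X\<rbrakk> \<Longrightarrow>
          vnorm X (vadd X x y) \<le> vnorm X x + vnorm X y"
    and norm_scale: "x \<in> carr X \<Longrightarrow> vnorm X (vscale X c x) = norm c * vnorm X x"

text \<open>
  The value 0 off the carrier is needed because \<open>Metric_space\<close> requires nonnegativity and symmetry
  of the distance on the whole type.
\<close>

definition ndist :: "('k::real_normed_field, 'a) nspace \<Rightarrow> 'a \<Rightarrow> 'a \<Rightarrow> real" where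
  "ndist X x y =
     (if x \<in> carr X \<and> y \<in> carr X then vnorm X (vadd X x (vscale X (- 1) y)) else 0)"

lemma (in normed_space) Metric_space_ndist: "Metric_space (carr X) (ndist X)"
proof -
  have sc0: "vscale X 0 x = vzero X" if "x \<in> carr X" for x
    using that norm_scale[OF that, of 0] norm_eq_zero[OF scale_closed[OF that]] by simp
  have neg: "vadd X x (vscale X (- 1) x) = vzero X" if "x \<in> carr X" for x
    using scale_add_left[OF that, of 1 "- 1"] sc0[OF that] scale_one[OF that] by simp
  have tri: "vnorm X (vadd X x (vscale X (- 1) z)) \<le>
      vnorm X (vadd X x (vscale X (- 1) y)) + vnorm X (vadd X y (vscale X (- 1) z))"
    if "x \<in> carr X" "y \<in> carr X" "z \<in> carr X" for x y z
  proof -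
    have nx: "vscale X (- 1) y \<in> carr X" "vscale X (- 1) z \<in> carr X"
      using that scale_closed by auto
    have "vadd X (vadd X x (vscale X (- 1) y)) (vadd X y (vscale X (- 1) z)) =
        vadd X x (vadd X (vadd X y (vscale X (- 1) y)) (vscale X (- 1) z))"
      using that nx by (simp add: add_assoc add_closed add_commute[of y "vscale X (- 1) y"])
    also have "\<dots> = vadd X x (vscale X (- 1) z)"
      using that nx
      by (metis neg add_commute add_zero zero_closed)
    finally show ?thesis
      using norm_triangle[of "vadd X x (vscale X (- 1) y)" "vadd X y (vscale X (- 1) z)"]
        that nx add_closed by simp
  qed
  have comm: "vnorm X (vadd X x (vscale X (- 1) y)) = vnorm X (vadd X y (vscale X (- 1) x))"
    if "x \<in> carr X" "y \<in> carr X" for x y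
  proof -
    have "vscale X (- 1) (vadd X x (vscale X (- 1) y)) = vadd X y (vscale X (- 1) x)"
      using that scale_closed[of x "- 1"] scale_closed[of y "- 1"]
      by (simp add: scale_add_right scale_scale scale_one add_commute)
    then show ?thesis
      using norm_scale[of "vadd X x (vscale X (- 1) y)" "- 1"] that add_closed scale_closed by simp
  qed
  have zero: "vnorm X (vadd X x (vscale X (- 1) y)) = 0 \<longleftrightarrow> x = y"
    if "x \<in> carr X" "y \<in> carr X" for x y
  proof -
    have n: "vscale X (- 1) y \<in> carr X" using that scale_closed by blast
    have "x = y" if "vadd X x (vscale X (- 1) y) = vzero X"
    proof -
      have "x = vadd X x (vadd X (vscale X (- 1) y) y)"
        using \<open>x \<in> carr X\<close> \<open>y \<in> carr X\<close> n neg add_commute add_zero by metis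
      also have "\<dots> = y"
        using \<open>x \<in> carr X\<close> \<open>y \<in> carr X\<close> n that
        by (metis add_assoc add_commute add_zero zero_closed)
      finally show ?thesis .
    qed
    then show ?thesis
      using that n neg norm_eq_zero add_closed by metis
  qed
  have "0 \<le> vnorm X (vadd X x (vscale X (- 1) y))" if "x \<in> carr X" "y \<in> carr X" for x y
    using tri[of x x y] tri[of x y x] comm[OF that] zero[of x x] that by auto
  then show ?thesis
    by unfold_locales (auto simp: ndist_def tri zero comm)
qed

definition banach_space :: "('k::real_normed_field, 'a) nspace \<Rightarrow> bool" where
  "banach_space X \<longleftrightarrow> normed_space X \<and> Metric_space.mcomplete (carr X) (ndist X)"

definition closed_subspace :: "('k::real_normed_field, 'a) nspace \<Rightarrow> 'a set \<Rightarrow> bool" where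
  "closed_subspace V A \<longleftrightarrow>
     A \<subseteq> carr V \<and> vzero V \<in> A \<and>
     (\<forall>x\<in>A. \<forall>y\<in>A. vadd V x y \<in> A) \<and> (\<forall>c. \<forall>x\<in>A. vscale V c x \<in> A) \<and>
     closedin (Metric_space.mtopology (carr V) (ndist V)) A"

text \<open>
  Density is spelled out because the quot_space norm is a priori only a seminorm when the subspace
  divided out is not yet known to be closed, so that \<open>Metric_space\<close> need not be available.
\<close>

definition dense_in :: "('k::real_normed_field, 'a) nspace \<Rightarrow> 'a set \<Rightarrow> bool" where
  "dense_in X D \<longleftrightarrow> D \<subseteq> carr X \<and> (\<forall>x\<in>carr X. \<forall>e>0. \<exists>d\<in>D. ndist X x d < e)"

definition set_add :: "('k, 'a) nspace \<Rightarrow> 'a set \<Rightarrow> 'a set \<Rightarrow> 'a set" where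
  "set_add V A B = {vadd V a b | a b. a \<in> A \<and> b \<in> B}"

definition subsp :: "('k, 'a) nspace \<Rightarrow> 'a set \<Rightarrow> ('k, 'a) nspace" where
  "subsp V A = V\<lparr>carr := A\<rparr>"

definition bounded_op ::
  "('k::real_normed_field, 'a) nspace \<Rightarrow> ('k, 'b) nspace \<Rightarrow> ('a \<Rightarrow> 'b) \<Rightarrow> bool" where
  "bounded_op X Y T \<longleftrightarrow>
     T \<in> carr X \<rightarrow> carr Y \<and>
     (\<forall>x\<in>carr X. \<forall>y\<in>carr X. T (vadd X x y) = vadd Y (T x) (T y)) \<and>
     (\<forall>c. \<forall>x\<in>carr X. T (vscale X c x) = vscale Y c (T x)) \<and>
     (\<exists>K. \<forall>x\<in>carr X. vnorm Y (T x) \<le> K * vnorm X x)"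


subsection \<open>Quotients\<close>

text \<open>
  In \<open>vscale\<close> the summand from \<open>A\<close> only matters for the scalar 0, where the result has to be \<open>A\<close>.
\<close>

definition qmap :: "('k, 'a) nspace \<Rightarrow> 'a set \<Rightarrow> 'a \<Rightarrow> 'a set" where
  "qmap V A x = {vadd V x a | a. a \<in> A}"

definition quot_space :: "('k, 'a) nspace \<Rightarrow> 'a set \<Rightarrow> ('k, 'a set) nspace" where
  "quot_space V A =
     \<lparr>carr = qmap V A ` carr V,
      vadd = set_add V,
      vzero = A,
      vscale = (\<lambda>c C. {vadd V (vscale V c x) a | x a. x \<in> C \<and> a \<in> A}),
      vnorm = (\<lambda>C. INF x\<in>C. vnorm V x)\<rparr>"

definition incl :: "'a set \<Rightarrow> 'a \<Rightarrow> 'a" where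
  "incl A = (\<lambda>x\<in>A. x)"

text \<open>The operator \<open>Q\<^sub>B J\<^sub>A : A \<rightarrow> V/B\<close>.\<close>

definition pair_op :: "('k, 'a) nspace \<Rightarrow> 'a set \<Rightarrow> 'a set \<Rightarrow> 'a \<Rightarrow> 'a set" where
  "pair_op V A B = qmap V B \<circ> incl A"


subsection \<open>Duals\<close>

definition scalars :: "('k::real_normed_field, 'k) nspace" where
  "scalars = \<lparr>carr = UNIV, vadd = (+), vzero = 0, vscale = (*), vnorm = norm\<rparr>"

text \<open>
  Functionals are made extensional outside the carrier, so that equal functionals are equal as
  HOL functions.
\<close>

definition dual :: "('k::real_normed_field, 'a) nspace \<Rightarrow> ('k, 'a \<Rightarrow> 'k) nspace" where
  "dual X =
     \<lparr>carr = {f \<in> extensional (carr X). bounded_op X scalars f},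
      vadd = (\<lambda>f g. \<lambda>x\<in>carr X. f x + g x),
      vzero = (\<lambda>x\<in>carr X. 0),
      vscale = (\<lambda>c f. \<lambda>x\<in>carr X. c * f x),
      vnorm = (\<lambda>f. SUP x\<in>{x \<in> carr X. vnorm X x \<le> 1}. norm (f x))\<rparr>"

abbreviation bidual ::
  "('k::real_normed_field, 'a) nspace \<Rightarrow> ('k, ('a \<Rightarrow> 'k) \<Rightarrow> 'k) nspace" where
  "bidual X \<equiv> dual (dual X)"

definition canon :: "('k::real_normed_field, 'a) nspace \<Rightarrow> 'a \<Rightarrow> ('a \<Rightarrow> 'k) \<Rightarrow> 'k" where
  "canon X x = (\<lambda>f\<in>carr (dual X). f x)"

definition canon_image :: "('k::real_normed_field, 'a) nspace \<Rightarrow> (('a \<Rightarrow> 'k) \<Rightarrow> 'k) set" where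
  "canon_image X = canon X ` carr X"

text \<open>The conjugate of \<open>T : X \<rightarrow> Y\<close>, to be applied to \<open>g \<in> carr (dual Y)\<close>.\<close>

definition conj_op :: "('k, 'a) nspace \<Rightarrow> ('a \<Rightarrow> 'b) \<Rightarrow> ('b \<Rightarrow> 'k) \<Rightarrow> ('a \<Rightarrow> 'k)" where
  "conj_op X T g = (\<lambda>x\<in>carr X. g (T x))"

definition annihilator :: "('k::real_normed_field, 'a) nspace \<Rightarrow> 'a set \<Rightarrow> ('a \<Rightarrow> 'k) set" where
  "annihilator V A = {f \<in> carr (dual V). \<forall>x\<in>A. f x = 0}"


subsection \<open>Tauberian and cotauberian operators and pairs\<close>

definition tauberian ::
  "('k::real_normed_field, 'a) nspace \<Rightarrow> ('k, 'b) nspace \<Rightarrow> ('a \<Rightarrow> 'b) \<Rightarrow> bool" where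
  "tauberian X Y S \<longleftrightarrow> bounded_op X Y S \<and>
     conj_op (dual Y) (conj_op X S) ` (carr (bidual X) - canon_image X)
       \<subseteq> carr (bidual Y) - canon_image Y"

definition cotauberian ::
  "('k::real_normed_field, 'a) nspace \<Rightarrow> ('k, 'b) nspace \<Rightarrow> ('a \<Rightarrow> 'b) \<Rightarrow> bool" where
  "cotauberian X Y S \<longleftrightarrow> bounded_op X Y S \<and> tauberian (dual Y) (dual X) (conj_op X S)"

definition W_plus :: "('k::real_normed_field, 'a) nspace \<Rightarrow> ('a set \<times> 'a set) set" where
  "W_plus V = {(A, B). closed_subspace V A \<and> closed_subspace V B \<and>
     tauberian (subsp V A) (quot_space V B) (pair_op V A B)}"

definition W_minus :: "('k::real_normed_field, 'a) nspace \<Rightarrow> ('a set \<times> 'a set) set" where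
  "W_minus V = {(A, B). closed_subspace V A \<and> closed_subspace V B \<and>
     cotauberian (subsp V A) (quot_space V B) (pair_op V A B)}"


subsection \<open>The residuum space\<close>

definition co_space ::
  "('k::real_normed_field, 'a) nspace \<Rightarrow> ('k, (('a \<Rightarrow> 'k) \<Rightarrow> 'k) set) nspace" where
  "co_space Z = quot_space (bidual Z) (canon_image Z)"

definition co_sub ::
  "('k::real_normed_field, 'a) nspace \<Rightarrow> 'a set \<Rightarrow> (('a \<Rightarrow> 'k) \<Rightarrow> 'k) set set" where
  "co_sub Z M = qmap (bidual Z) (canon_image Z) `
     set_add (bidual Z) (annihilator (dual Z) (annihilator Z M)) (canon_image Z)"

end

theory Submission
  imports Defs
begin

text \<open>
  All three assertions are equivalent to the vanishing of every \<open>F \<in> Z\<^sup>*\<^sup>*\<^sup>*\<close> that annihilates \<open>Z\<close>,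
  \<open>M\<^sup>\<bottom>\<^sup>\<bottom>\<close> and \<open>N\<^sup>\<bottom>\<^sup>\<bottom>\<close>. For (3) this is the Hahn-Banach theorem, since \<open>M\<^sup>c\<^sup>o + N\<^sup>c\<^sup>o\<close> is dense in \<open>Z\<^sup>c\<^sup>o\<close>
  iff \<open>M\<^sup>\<bottom>\<^sup>\<bottom> + N\<^sup>\<bottom>\<^sup>\<bottom> + Z\<close> is dense in \<open>Z\<^sup>*\<^sup>*\<close>. For (1) and (2), the conjugate of \<open>M \<rightarrow> Z/N\<close> is
  \<open>N\<^sup>\<bottom> \<rightarrow> Z\<^sup>*/M\<^sup>\<bottom>\<close> up to isomorphism. The second conjugate of the latter, read on \<open>N\<^sup>\<bottom>\<^sup>\<bottom>\<^sup>\<bottom>\<close>, sends \<open>F\<close>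
  into \<open>Z\<^sup>*/M\<^sup>\<bottom>\<close> iff \<open>F \<in> v + M\<^sup>\<bottom>\<^sup>\<bottom>\<^sup>\<bottom>\<close> for some \<open>v \<in> Z\<^sup>*\<close>. The restriction \<open>f\<close> of such an \<open>F\<close> to \<open>Z\<close> lies in
  \<open>N\<^sup>\<bottom>\<close>, and \<open>F - f\<close> annihilates \<open>Z\<close>, \<open>M\<^sup>\<bottom>\<^sup>\<bottom>\<close> and \<open>N\<^sup>\<bottom>\<^sup>\<bottom>\<close>.
\<close>

subsection \<open>Seminormed spaces\<close>

text \<open>
  Seminorms are admitted so that quotients need no closedness.
\<close>

locale seminormed_space =
  fixes X :: "('k::real_normed_field, 'a) nspace"
  assumes zero_closed [simp, intro]: "vzero X \<in> carr X"
    and add_closed [simp, intro]: "\<lbrakk>x \<in> carr X; y \<in> carr X\<rbrakk> \<Longrightarrow> vadd X x y \<in> carr X"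
    and scale_closed [simp, intro]: "x \<in> carr X \<Longrightarrow> vscale X c x \<in> carr X"
    and add_assoc: "\<lbrakk>x \<in> carr X; y \<in> carr X; z \<in> carr X\<rbrakk> \<Longrightarrow>
          vadd X (vadd X x y) z = vadd X x (vadd X y z)"
    and add_commute: "\<lbrakk>x \<in> carr X; y \<in> carr X\<rbrakk> \<Longrightarrow> vadd X x y = vadd X y x"
    and add_zero [simp]: "x \<in> carr X \<Longrightarrow> vadd X x (vzero X) = x"
    and scale_add_right: "\<lbrakk>x \<in> carr X; y \<in> carr X\<rbrakk> \<Longrightarrow>
          vscale X c (vadd X x y) = vadd X (vscale X c x) (vscale X c y)"
    and scale_add_left: "x \<in> carr X \<Longrightarrow>
          vscale X (c + d) x = vadd X (vscale X c x) (vscale X d x)"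
    and scale_scale [simp]: "x \<in> carr X \<Longrightarrow> vscale X c (vscale X d x) = vscale X (c * d) x"
    and scale_one [simp]: "x \<in> carr X \<Longrightarrow> vscale X 1 x = x"
    and scale_zero_left [simp]: "x \<in> carr X \<Longrightarrow> vscale X 0 x = vzero X"
    and norm_triangle: "\<lbrakk>x \<in> carr X; y \<in> carr X\<rbrakk> \<Longrightarrow>
          vnorm X (vadd X x y) \<le> vnorm X x + vnorm X y"
    and norm_scale [simp]: "x \<in> carr X \<Longrightarrow> vnorm X (vscale X c x) = norm c * vnorm X x"
begin

lemma add_left_commute:
  "\<lbrakk>x \<in> carr X; y \<in> carr X; z \<in> carr X\<rbrakk> \<Longrightarrow> vadd X x (vadd X y z) = vadd X y (vadd X x z)"
  by (metis add_assoc add_commute)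

lemmas add_ac = add_assoc add_commute add_left_commute

lemma zero_add [simp]: "x \<in> carr X \<Longrightarrow> vadd X (vzero X) x = x"
  using add_commute add_zero by fastforce

lemma scale_zero_right [simp]: "vscale X c (vzero X) = vzero X"
  by (metis mult_zero_right scale_scale scale_zero_left zero_closed)

lemma add_minus [simp]: "x \<in> carr X \<Longrightarrow> vadd X x (vscale X (- 1) x) = vzero X"
  by (metis add.right_inverse scale_add_left scale_one scale_zero_left)

lemma add_minus_cancel [simp]:
  "\<lbrakk>x \<in> carr X; y \<in> carr X\<rbrakk> \<Longrightarrow> vadd X x (vadd X (vscale X (- 1) x) y) = y"
  by (metis add_assoc add_minus scale_closed zero_add)

lemma norm_zero [simp]: "vnorm X (vzero X) = 0"
  using norm_scale[of "vzero X" 0] by simp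

lemma norm_nonneg [simp]: "x \<in> carr X \<Longrightarrow> 0 \<le> vnorm X x"
  using norm_triangle[of x "vscale X (- 1) x"] by simp

end

lemma (in normed_space) seminormed: "seminormed_space X"
proof
  show "vscale X 0 x = vzero X" if "x \<in> carr X" for x
    using that norm_scale[OF that, of 0] norm_eq_zero[OF scale_closed[OF that]] by simp
qed (fact zero_closed add_closed scale_closed add_assoc add_commute add_zero scale_add_right
  scale_add_left scale_scale scale_one norm_triangle norm_scale)+

lemma (in seminormed_space) normedI:
  assumes "\<And>x. x \<in> carr X \<Longrightarrow> vnorm X x = 0 \<Longrightarrow> x = vzero X"
  shows "normed_space X"
proof
  show "\<exists>y\<in>carr X. vadd X x y = vzero X" if "x \<in> carr X" for x
    using that add_minus scale_closed by blast
  show "vnorm X x = 0 \<longleftrightarrow> x = vzero X" if "x \<in> carr X" for x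
    using that assms by auto
qed (fact zero_closed add_closed scale_closed add_assoc add_commute add_zero scale_add_right
  scale_add_left scale_scale scale_one norm_triangle norm_scale)+

text \<open>The algebraic part of \<open>closed_subspace\<close>. It passes to images and sums of
  subspaces, and so is the notion available for \<open>co_sub Z M\<close>.\<close>

definition lin_subspace :: "('k::real_normed_field, 'a) nspace \<Rightarrow> 'a set \<Rightarrow> bool" where
  "lin_subspace V A \<longleftrightarrow> A \<subseteq> carr V \<and> vzero V \<in> A \<and>
     (\<forall>x\<in>A. \<forall>y\<in>A. vadd V x y \<in> A) \<and> (\<forall>c. \<forall>x\<in>A. vscale V c x \<in> A)"

lemma closed_subspace_imp_lin_subspace: "closed_subspace V A \<Longrightarrow> lin_subspace V A"
  by (simp add: closed_subspace_def lin_subspace_def)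

lemma lin_subspaceD:
  assumes "lin_subspace V A"
  shows "A \<subseteq> carr V" "\<And>x. x \<in> A \<Longrightarrow> x \<in> carr V" "vzero V \<in> A"
    "\<And>x y. x \<in> A \<Longrightarrow> y \<in> A \<Longrightarrow> vadd V x y \<in> A"
    "\<And>c x. x \<in> A \<Longrightarrow> vscale V c x \<in> A"
  using assms by (auto simp: lin_subspace_def)

lemma carr_subsp [simp]: "carr (subsp V A) = A"
  and vadd_subsp [simp]: "vadd (subsp V A) = vadd V"
  and vzero_subsp [simp]: "vzero (subsp V A) = vzero V"
  and vscale_subsp [simp]: "vscale (subsp V A) = vscale V"
  and vnorm_subsp [simp]: "vnorm (subsp V A) = vnorm V"
  by (simp_all add: subsp_def)

lemma (in seminormed_space) seminormed_subsp:
  assumes A: "lin_subspace X A"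
  shows "seminormed_space (subsp X A)"
proof -
  note [simp] = lin_subspaceD(2-)[OF A]
  show ?thesis
    by unfold_locales
      (simp_all add: add_ac scale_add_right scale_add_left norm_triangle)
qed

subsection \<open>Quotients\<close>

lemma carr_quot [simp]: "carr (quot_space V A) = qmap V A ` carr V"
  and vzero_quot [simp]: "vzero (quot_space V A) = A"
  by (simp_all add: quot_space_def)

locale seminormed_quotient = seminormed_space V
  for V :: "('k::real_normed_field, 'a) nspace" +
  fixes A :: "'a set"
  assumes A: "lin_subspace V A"
begin

lemmas A_rules [simp] = lin_subspaceD(2-)[OF A]

lemma self_in_qmap: "x \<in> carr V \<Longrightarrow> x \<in> qmap V A x"
  unfolding qmap_def by (metis (mono_tags, lifting) A_rules(2) add_zero mem_Collect_eq)

lemma qmap_subset_carr: "x \<in> carr V \<Longrightarrow> qmap V A x \<subseteq> carr V"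
  by (auto simp: qmap_def)

lemma qmap_add_right:
  assumes "x \<in> carr V" "a \<in> A"
  shows "qmap V A (vadd V x a) = qmap V A x"
proof (intro equalityI subsetI)
  fix y assume "y \<in> qmap V A (vadd V x a)"
  then obtain b where "b \<in> A" "y = vadd V (vadd V x a) b" by (auto simp: qmap_def)
  then have "y = vadd V x (vadd V a b)" "vadd V a b \<in> A" using assms by (simp_all add: add_assoc)
  then show "y \<in> qmap V A x" unfolding qmap_def by blast
next
  fix y assume "y \<in> qmap V A x"
  then obtain b where b: "b \<in> A" "y = vadd V x b" by (auto simp: qmap_def)
  let ?c = "vadd V (vscale V (- 1) a) b"
  have "y = vadd V (vadd V x a) ?c" "?c \<in> A" using assms b by (simp_all add: add_assoc)
  then show "y \<in> qmap V A (vadd V x a)" unfolding qmap_def by blast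
qed

lemma qmap_eqE:
  assumes "qmap V A x = qmap V A y" "y \<in> carr V"
  obtains a where "a \<in> A" "y = vadd V x a"
  using self_in_qmap[OF assms(2)] assms(1) by (auto simp: qmap_def)

lemma qmap_zero: "qmap V A (vzero V) = A"
  unfolding qmap_def using A_rules(1) zero_add by force

lemma qmap_of_mem: "a \<in> A \<Longrightarrow> qmap V A a = A"
  using qmap_add_right[of "vzero V" a] by (simp add: qmap_zero)

lemma vadd_quot:
  assumes "x \<in> carr V" "y \<in> carr V"
  shows "vadd (quot_space V A) (qmap V A x) (qmap V A y) = qmap V A (vadd V x y)"
proof -
  have eq: "vadd V (vadd V x a) (vadd V y b) = vadd V (vadd V x y) (vadd V a b)"
    if "a \<in> A" "b \<in> A" for a b
    using assms that by (simp add: add_ac)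
  have "vadd V (vadd V x y) c \<in> set_add V (qmap V A x) (qmap V A y)" if "c \<in> A" for c
    unfolding set_add_def qmap_def using eq[OF that A_rules(2)] that
    by simp (metis A_rules(1,2) add_zero)
  moreover have "vadd V (vadd V x a) (vadd V y b) \<in> qmap V A (vadd V x y)"
    if "a \<in> A" "b \<in> A" for a b
    using eq[OF that] that by (auto simp: qmap_def)
  ultimately show ?thesis
    by (auto simp: quot_space_def) (auto simp: qmap_def set_add_def)
qed

lemma vscale_quot:
  assumes "x \<in> carr V"
  shows "vscale (quot_space V A) c (qmap V A x) = qmap V A (vscale V c x)"
proof -
  have eq: "vadd V (vscale V c (vadd V x a)) b = vadd V (vscale V c x) (vadd V (vscale V c a) b)"
    if "a \<in> A" "b \<in> A" for a b
    using assms that by (simp add: scale_add_right add_assoc)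
  have "\<exists>y a. vadd V (vscale V c x) b = vadd V (vscale V c y) a \<and> y \<in> qmap V A x \<and> a \<in> A"
    if "b \<in> A" for b
    using self_in_qmap[OF assms] that by blast
  moreover have "vadd V (vscale V c (vadd V x a)) b \<in> qmap V A (vscale V c x)"
    if "a \<in> A" "b \<in> A" for a b
    using eq[OF that] that by (auto simp: qmap_def)
  ultimately show ?thesis
    by (auto simp: quot_space_def) (auto simp: qmap_def)
qed

text \<open>The quotient norm is an infimum over a coset and bounded below by 0. This rule and the
  next two express that infimum through representatives \<open>x + a\<close>, so that it need not be
  unfolded again.\<close>

lemma norm_quot_le:
  assumes "x \<in> carr V" "a \<in> A"
  shows "vnorm (quot_space V A) (qmap V A x) \<le> vnorm V (vadd V x a)"
proof -
  have "bdd_below (vnorm V ` qmap V A x)"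
    using qmap_subset_carr[OF assms(1)] by (intro bdd_belowI[of _ 0]) auto
  then show ?thesis
    unfolding quot_space_def nspace.simps by (rule cINF_lower) (use assms in \<open>auto simp: qmap_def\<close>)
qed

lemma norm_quot_less:
  assumes "x \<in> carr V" "vnorm (quot_space V A) (qmap V A x) < e"
  obtains a where "a \<in> A" "vnorm V (vadd V x a) < e"
proof -
  have "bdd_below (vnorm V ` qmap V A x)"
    using qmap_subset_carr[OF assms(1)] by (intro bdd_belowI[of _ 0]) auto
  then have "\<exists>y\<in>qmap V A x. vnorm V y < e"
    using assms self_in_qmap[OF assms(1)] cINF_less_iff[of "qmap V A x" "vnorm V" e]
    by (auto simp: quot_space_def)
  then show ?thesis
    using that by (auto simp: qmap_def)
qed

lemma norm_quot_greatest:
  assumes "x \<in> carr V" "\<And>a. a \<in> A \<Longrightarrow> r \<le> vnorm V (vadd V x a)"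
  shows "r \<le> vnorm (quot_space V A) (qmap V A x)"
  using norm_quot_less[OF assms(1)] assms(2) by (metis linorder_not_le)

lemma norm_quot_le_norm:
  "x \<in> carr V \<Longrightarrow> vnorm (quot_space V A) (qmap V A x) \<le> vnorm V x"
  using norm_quot_le[of x "vzero V"] by simp

lemma norm_quot_nonneg: "x \<in> carr V \<Longrightarrow> 0 \<le> vnorm (quot_space V A) (qmap V A x)"
  by (rule norm_quot_greatest) auto

text \<open>For the triangle inequality, representatives within e/2 of the two infima are added.
  Homogeneity reduces to one inequality, used for c and for its inverse.\<close>

lemma seminormed_quot: "seminormed_space (quot_space V A)"
proof (unfold_locales, goal_cases)
  case (12 C D)
  then obtain x y where x: "x \<in> carr V" "C = qmap V A x" and y: "y \<in> carr V" "D = qmap V A y"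
    by auto
  show ?case
  proof (rule field_le_epsilon)
    fix e :: real assume "0 < e"
    obtain a where a: "a \<in> A" "vnorm V (vadd V x a) < vnorm (quot_space V A) C + e/2"
      using norm_quot_less[OF x(1), of "vnorm (quot_space V A) C + e/2"] x \<open>0 < e\<close> by auto
    obtain b where b: "b \<in> A" "vnorm V (vadd V y b) < vnorm (quot_space V A) D + e/2"
      using norm_quot_less[OF y(1), of "vnorm (quot_space V A) D + e/2"] y \<open>0 < e\<close> by auto
    have "vadd V (vadd V x y) (vadd V a b) = vadd V (vadd V x a) (vadd V y b)"
      using a b x y by (simp add: add_ac)
    then have "vnorm V (vadd V (vadd V x y) (vadd V a b))
        \<le> vnorm V (vadd V x a) + vnorm V (vadd V y b)"
      using norm_triangle[of "vadd V x a" "vadd V y b"] a b x y by simp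
    then show "vnorm (quot_space V A) (vadd (quot_space V A) C D)
        \<le> vnorm (quot_space V A) C + vnorm (quot_space V A) D + e"
      using norm_quot_le[of "vadd V x y" "vadd V a b"] a b x y by (simp add: vadd_quot)
  qed
next
  case (13 C c)
  then obtain x where x: "x \<in> carr V" "C = qmap V A x" by auto
  have le: "vnorm (quot_space V A) (qmap V A (vscale V d z))
      \<le> norm d * vnorm (quot_space V A) (qmap V A z)" if z: "z \<in> carr V" for d z
  proof (cases "d = 0")
    case True
    then show ?thesis using norm_quot_le_norm[of "vzero V"] z by simp
  next
    case False
    have "vnorm (quot_space V A) (qmap V A (vscale V d z)) / norm d
        \<le> vnorm V (vadd V z a)" if a: "a \<in> A" for a
    proof -
      have "vnorm (quot_space V A) (qmap V A (vscale V d z))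
        \<le> vnorm V (vscale V d (vadd V z a))"
        using norm_quot_le[of "vscale V d z" "vscale V d a"] z a
        by (simp add: scale_add_right del: norm_scale)
      then show ?thesis using z a False by (simp add: field_simps)
    qed
    then have "vnorm (quot_space V A) (qmap V A (vscale V d z)) / norm d
        \<le> vnorm (quot_space V A) (qmap V A z)"
      by (rule norm_quot_greatest[OF z])
    then show ?thesis using False by (simp add: field_simps)
  qed
  have "norm c * vnorm (quot_space V A) (qmap V A x)
      \<le> vnorm (quot_space V A) (qmap V A (vscale V c x))"
  proof (cases "c = 0")
    case True
    then show ?thesis using norm_quot_nonneg[of "vzero V"] x by simp
  next
    case False
    then show ?thesis
      using le[of "vscale V c x" "inverse c"] x by (simp add: norm_inverse norm_divide field_simps)
  qed
  then show ?case using le[OF x(1), of c] x by (simp add: vscale_quot)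
next
  case 1
  show ?case by simp (metis image_eqI qmap_zero zero_closed)
next
  case (5 C D)
  then show ?case by (auto simp: vadd_quot add_commute)
next
  case (6 C)
  then show ?case using vadd_quot[of _ "vzero V"] by (auto simp: qmap_zero)
next
  case (2 C D)
  then show ?case by (auto simp: vadd_quot)
next
  case (3 C c)
  then show ?case by (auto simp: vscale_quot)
next
  case (4 C D E)
  then show ?case by (auto simp: vadd_quot add_assoc)
next
  case (7 C D c)
  then show ?case by (auto simp: vadd_quot vscale_quot scale_add_right)
next
  case (8 C c d)
  then show ?case by (auto simp: vadd_quot vscale_quot scale_add_left)
next
  case (9 C c d)
  then show ?case by (auto simp: vscale_quot)
next
  case (10 C)
  then show ?case by (auto simp: vscale_quot)
next
  case (11 C)
  then show ?case by (auto simp: vscale_quot qmap_zero)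
qed

end

subsection \<open>Duals\<close>

lemma vadd_dual: "vadd (dual X) f g = (\<lambda>x\<in>carr X. f x + g x)"
  and vzero_dual: "vzero (dual X) = (\<lambda>x\<in>carr X. 0)"
  and vscale_dual: "vscale (dual X) c f = (\<lambda>x\<in>carr X. c * f x)"
  by (simp_all add: dual_def)

lemma dual_apply [simp]:
  assumes "x \<in> carr X"
  shows "vadd (dual X) f g x = f x + g x" "vzero (dual X) x = 0" "vscale (dual X) c f x = c * f x"
  using assms by (simp_all add: dual_def)

lemma dualI:
  assumes "f \<in> extensional (carr X)"
    and "\<And>x y. x \<in> carr X \<Longrightarrow> y \<in> carr X \<Longrightarrow> f (vadd X x y) = f x + f y"
    and "\<And>c x. x \<in> carr X \<Longrightarrow> f (vscale X c x) = c * f x"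
    and "\<And>x. x \<in> carr X \<Longrightarrow> norm (f x) \<le> K * vnorm X x"
  shows "f \<in> carr (dual X)"
  using assms by (fastforce simp: dual_def bounded_op_def scalars_def)

lemma dualD:
  assumes "f \<in> carr (dual X)"
  shows "f \<in> extensional (carr X)"
    "\<And>x y. x \<in> carr X \<Longrightarrow> y \<in> carr X \<Longrightarrow> f (vadd X x y) = f x + f y"
    "\<And>c x. x \<in> carr X \<Longrightarrow> f (vscale X c x) = c * f x"
  using assms by (auto simp: dual_def bounded_op_def scalars_def)

lemma dual_eqI:
  assumes "f \<in> carr (dual X)" "g \<in> carr (dual X)" "\<And>x. x \<in> carr X \<Longrightarrow> f x = g x"
  shows "f = g"
  using assms by (meson dualD(1) extensionalityI)

context seminormed_space
begin

lemma dual_zero: "f \<in> carr (dual X) \<Longrightarrow> f (vzero X) = 0"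
  using dualD(3)[of f X "vzero X" 0] by simp

text \<open>Vectors of positive seminorm are scaled to seminorm 1. On vectors of seminorm 0 no
  scaling is possible, but there any bound K of f already forces \<open>f x = 0\<close>.\<close>

lemma norm_le_dual_norm:
  assumes f: "f \<in> carr (dual X)" and x: "x \<in> carr X"
  shows "norm (f x) \<le> vnorm (dual X) f * vnorm X x"
proof -
  obtain K where "\<forall>x\<in>carr X. norm (f x) \<le> K * vnorm X x"
    using f by (auto simp: dual_def bounded_op_def scalars_def)
  then have K: "norm (f x) \<le> K * vnorm X x" if "x \<in> carr X" for x
    using that by blast
  \<comment> \<open>K can be negative when every vector has seminorm 0; hence the absolute
    value.\<close>
  have ball: "norm (f y) \<le> vnorm (dual X) f" if y: "y \<in> carr X" "vnorm X y \<le> 1" for y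
  proof -
    have "norm (f z) \<le> \<bar>K\<bar>" if "z \<in> carr X" "vnorm X z \<le> 1" for z
    proof -
      have "K * vnorm X z \<le> \<bar>K\<bar> * 1"
        using that by (intro mult_mono) auto
      then show ?thesis using K[OF that(1)] by simp
    qed
    then have "bdd_above ((\<lambda>x. norm (f x)) ` {x \<in> carr X. vnorm X x \<le> 1})"
      by (intro bdd_aboveI[of _ "\<bar>K\<bar>"]) auto
    then show ?thesis
      unfolding dual_def nspace.simps by (rule cSUP_upper[rotated]) (use y in auto)
  qed
  show ?thesis
  proof (cases "vnorm X x = 0")
    case True
    then show ?thesis using K[OF x] by simp
  next
    case False
    then have pos: "vnorm X x > 0"
      using norm_nonneg[OF x] by linarith
    have "norm (f (vscale X (of_real (inverse (vnorm X x))) x)) \<le> vnorm (dual X) f"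
      using pos by (intro ball) (use x in \<open>auto simp: norm_inverse\<close>)
    then show ?thesis
      using pos x f by (simp add: dualD(3) norm_mult norm_divide field_simps)
  qed
qed

lemma dual_norm_le:
  assumes "\<And>x. x \<in> carr X \<Longrightarrow> norm (f x) \<le> K * vnorm X x" "0 \<le> K"
  shows "vnorm (dual X) f \<le> K"
  unfolding dual_def nspace.simps
proof (rule cSUP_least)
  show "{x \<in> carr X. vnorm X x \<le> 1} \<noteq> {}"
    using zero_closed norm_zero by force
  show "norm (f x) \<le> K" if "x \<in> {x \<in> carr X. vnorm X x \<le> 1}" for x
  proof -
    have "K * vnorm X x \<le> K * 1"
      using that assms(2) by (intro mult_left_mono) auto
    then show ?thesis using assms(1)[of x] that by simp
  qed
qed

lemma dual_norm_nonneg: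
  assumes "f \<in> carr (dual X)"
  shows "0 \<le> vnorm (dual X) f"
proof -
  have "bdd_above ((\<lambda>x. norm (f x)) ` {x \<in> carr X. vnorm X x \<le> 1})"
  proof (rule bdd_aboveI)
    fix r assume "r \<in> (\<lambda>x. norm (f x)) ` {x \<in> carr X. vnorm X x \<le> 1}"
    then obtain x where x: "x \<in> carr X" "vnorm X x \<le> 1" "r = norm (f x)" by auto
    have "vnorm (dual X) f * vnorm X x \<le> \<bar>vnorm (dual X) f\<bar> * 1"
      using x by (intro mult_mono) auto
    then show "r \<le> \<bar>vnorm (dual X) f\<bar>"
      using norm_le_dual_norm[OF assms x(1)] x by simp
  qed
  then have "norm (f (vzero X)) \<le> vnorm (dual X) f"
    unfolding dual_def nspace.simps by (rule cSUP_upper[rotated]) simp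
  then show ?thesis by (meson norm_ge_zero order_trans)
qed

lemma zero_dual: "vzero (dual X) \<in> carr (dual X)"
  by (rule dualI[of _ _ 0]) (auto simp: vzero_dual)

lemma add_dual:
  assumes "f \<in> carr (dual X)" "g \<in> carr (dual X)"
  shows "vadd (dual X) f g \<in> carr (dual X)"
    and "vnorm (dual X) (vadd (dual X) f g) \<le> vnorm (dual X) f + vnorm (dual X) g"
proof -
  have bd: "norm (vadd (dual X) f g x) \<le> (vnorm (dual X) f + vnorm (dual X) g) * vnorm X x"
    if "x \<in> carr X" for x
    using norm_triangle_ineq[of "f x" "g x"] norm_le_dual_norm[OF assms(1) that]
      norm_le_dual_norm[OF assms(2) that] that by (simp add: distrib_right)
  have "vadd (dual X) f g \<in> extensional (carr X)"
    by (simp add: vadd_dual)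
  then show "vadd (dual X) f g \<in> carr (dual X)"
    by (rule dualI[OF _ _ _ bd]) (use assms in \<open>auto simp: dualD(2,3) algebra_simps\<close>)
  show "vnorm (dual X) (vadd (dual X) f g) \<le> vnorm (dual X) f + vnorm (dual X) g"
    by (rule dual_norm_le[OF bd]) (simp_all add: assms dual_norm_nonneg)
qed

lemma scale_dual:
  assumes "f \<in> carr (dual X)"
  shows "vscale (dual X) c f \<in> carr (dual X)"
    and "vnorm (dual X) (vscale (dual X) c f) \<le> norm c * vnorm (dual X) f"
proof -
  have bd: "norm (vscale (dual X) c f x) \<le> (norm c * vnorm (dual X) f) * vnorm X x"
    if "x \<in> carr X" for x
    using norm_le_dual_norm[OF assms(1) that] that by (simp add: norm_mult mult.assoc mult_left_mono)
  have "vscale (dual X) c f \<in> extensional (carr X)"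
    by (simp add: vscale_dual)
  then show "vscale (dual X) c f \<in> carr (dual X)"
    by (rule dualI[OF _ _ _ bd]) (use assms in \<open>auto simp: dualD(2,3) algebra_simps\<close>)
  show "vnorm (dual X) (vscale (dual X) c f) \<le> norm c * vnorm (dual X) f"
    by (rule dual_norm_le[OF bd]) (simp_all add: assms dual_norm_nonneg)
qed

lemma scale_scale_dual:
  assumes "f \<in> carr (dual X)"
  shows "vscale (dual X) c (vscale (dual X) d f) = vscale (dual X) (c * d) f"
  by (auto simp: vscale_dual mult.assoc)

lemma scale_one_dual:
  assumes "f \<in> carr (dual X)"
  shows "vscale (dual X) 1 f = f"
  using assms dualD(1)[OF assms] by (intro dual_eqI[OF scale_dual(1)]) auto

lemma seminormed_dual: "seminormed_space (dual X)"
proof (unfold_locales, goal_cases)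
  case (13 f c)
  show ?case
  proof (rule antisym[OF scale_dual(2)[OF 13]])
    \<comment> \<open>The upper estimate, applied to the functional \<open>c f\<close> and the
      scalar 1/c, becomes the lower one.\<close>
    show "norm c * vnorm (dual X) f \<le> vnorm (dual X) (vscale (dual X) c f)"
    proof (cases "c = 0")
      case True
      then show ?thesis using dual_norm_nonneg[OF scale_dual(1)[OF 13]] by simp
    next
      case False
      then show ?thesis
        using scale_dual(2)[OF scale_dual(1)[OF 13], of "inverse c" c]
          scale_scale_dual[OF 13, of "inverse c" c] scale_one_dual[OF 13]
        by (simp add: norm_divide field_simps)
    qed
  qed
next
  case (6 f)
  then show ?case by (intro dual_eqI[OF add_dual(1)[OF _ zero_dual]]) auto
next
  case (12 f g)
  then show ?case by (rule add_dual(2))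
next
  case (4 f g h)
  then show ?case by (auto simp: vadd_dual intro!: restrict_ext)
next
  case (5 f g)
  then show ?case by (auto simp: vadd_dual intro!: restrict_ext)
next
  case (7 f g c)
  then show ?case by (auto simp: vadd_dual vscale_dual distrib_left intro!: restrict_ext)
next
  case (8 f c d)
  then show ?case by (auto simp: vadd_dual vscale_dual distrib_right intro!: restrict_ext)
next
  case (11 f)
  then show ?case by (auto simp: vscale_dual vzero_dual intro!: restrict_ext)
qed (simp_all add: zero_dual add_dual(1) scale_dual(1) scale_scale_dual scale_one_dual)

text \<open>A functional of norm 0 vanishes everywhere, even on a space that is only seminormed.
  Hence \<open>dual X\<close> carries a metric, and closedness of annihilators can be proved in
  it.\<close>

lemma normed_dual: "normed_space (dual X)"
proof -
  interpret D: seminormed_space "dual X" by (rule seminormed_dual)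
  show ?thesis
  proof (rule D.normedI)
    fix f assume f: "f \<in> carr (dual X)" "vnorm (dual X) f = 0"
    show "f = vzero (dual X)"
      using norm_le_dual_norm[OF f(1)] f by (intro dual_eqI[OF f(1) zero_dual]) auto
  qed
qed

end

subsection \<open>The Hahn-Banach theorem\<close>

text \<open>
  Partially defined real-linear functionals are handled through their graphs; single-valuedness
  follows from the domination.
\<close>

definition dominated_graph ::
  "('k::real_normed_field, 'a) nspace \<Rightarrow> real \<Rightarrow> ('a \<times> real) set \<Rightarrow> bool" where
  "dominated_graph X K G \<longleftrightarrow> (vzero X, 0) \<in> G \<and>
     (\<forall>x r y s. (x, r) \<in> G \<longrightarrow> (y, s) \<in> G \<longrightarrow> (vadd X x y, r + s) \<in> G) \<and>
     (\<forall>t x r. (x, r) \<in> G \<longrightarrow> (vscale X (of_real t) x, t * r) \<in> G) \<and>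
     (\<forall>x r. (x, r) \<in> G \<longrightarrow> x \<in> carr X \<and> r \<le> K * vnorm X x)"

lemma dominated_graphD:
  assumes "dominated_graph X K G"
  shows "(vzero X, 0) \<in> G"
    "\<And>x r y s. (x, r) \<in> G \<Longrightarrow> (y, s) \<in> G \<Longrightarrow> (vadd X x y, r + s) \<in> G"
    "\<And>t x r. (x, r) \<in> G \<Longrightarrow> (vscale X (of_real t) x, t * r) \<in> G"
    "\<And>x r. (x, r) \<in> G \<Longrightarrow> x \<in> carr X"
    "\<And>x r. (x, r) \<in> G \<Longrightarrow> r \<le> K * vnorm X x"
  using assms unfolding dominated_graph_def by blast+

text \<open>The difference of two pairs over x is \<open>(0, r - s)\<close>, and domination at 0
  gives \<open>r - s \<le> 0\<close>. Exchanging the pairs gives equality.\<close>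

lemma (in seminormed_space) dominated_graph_unique:
  assumes G: "dominated_graph X K G" and "(x, r) \<in> G" "(x, s) \<in> G"
  shows "r = s"
proof -
  note D = dominated_graphD[OF G]
  have le: "a \<le> b" if "(x, a) \<in> G" "(x, b) \<in> G" for a b
    using D(5)[OF D(2)[OF that(1) D(3)[OF that(2), of "- 1"]]] D(4)[OF that(1)] by simp
  show ?thesis using le assms(2,3) by (meson antisym)
qed

text \<open>The one-vector step of Hahn-Banach: z receives a value c between a supremum and an
  infimum dictated by the domination. If z is already in the domain of G, both of them equal its old
  value.\<close>

lemma (in seminormed_space) dominated_graph_extend:
  assumes G: "dominated_graph X K G" and K: "0 \<le> K" and z: "z \<in> carr X"
  obtains H c where "dominated_graph X K H" "G \<subseteq> H" "(z, c) \<in> H"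
proof -
  note D = dominated_graphD[OF G]
  let ?p = "\<lambda>x. K * vnorm X x"
  \<comment> \<open>Since \<open>x + y = (x - z) + (y + z)\<close>, every lower bound for c lies
    below every upper bound.\<close>
  have gap: "r - ?p (vadd X x (vscale X (- 1) z)) \<le> ?p (vadd X y z) - s"
    if "(x, r) \<in> G" "(y, s) \<in> G" for x r y s
  proof -
    have xy: "x \<in> carr X" "y \<in> carr X" using that D(4) by auto
    have "vadd X x y = vadd X (vadd X x (vscale X (- 1) z)) (vadd X y z)"
      using xy z by (simp add: add_ac)
    then have "vnorm X (vadd X x y) \<le> vnorm X (vadd X x (vscale X (- 1) z)) + vnorm X (vadd X y z)"
      using xy z by (simp add: norm_triangle)
    then have "?p (vadd X x y) \<le> ?p (vadd X x (vscale X (- 1) z)) + ?p (vadd X y z)"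
      using K by (metis distrib_left mult_left_mono)
    then show ?thesis using D(5)[OF D(2)[OF that]] by linarith
  qed
  \<comment> \<open>The least admissible value: \<open>gap\<close> makes the supremum finite and
    keeps it below all upper bounds.\<close>
  define c where "c = (SUP (x, r)\<in>G. r - ?p (vadd X x (vscale X (- 1) z)))"
  have lower: "r - ?p (vadd X x (vscale X (- 1) z)) \<le> c" if "(x, r) \<in> G" for x r
  proof -
    have "bdd_above ((\<lambda>(x, r). r - ?p (vadd X x (vscale X (- 1) z))) ` G)"
      by (intro bdd_aboveI[of _ "?p (vadd X (vzero X) z) - 0"]) (use gap[OF _ D(1)] z in auto)
    from cSUP_upper[OF that this] show ?thesis by (simp add: c_def)
  qed
  have upper: "c \<le> ?p (vadd X y z) - s" if "(y, s) \<in> G" for y s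
    unfolding c_def by (rule cSUP_least) (use gap that D(1) in auto)
  define H where "H = {(vadd X x (vscale X (of_real t) z), r + t * c) | x r t. (x, r) \<in> G}"
  have HI: "(vadd X x (vscale X (of_real t) z), r + t * c) \<in> H" if "(x, r) \<in> G" for x r t
    using that by (auto simp: H_def)
  have dom: "r + t * c \<le> ?p (vadd X x (vscale X (of_real t) z))" if xr: "(x, r) \<in> G" for x r t
  proof -
    have x: "x \<in> carr X" using xr D(4) by auto
    \<comment> \<open>By homogeneity, dividing by t > 0 leads to \<open>upper\<close> at x/t, and
      dividing by -t > 0 leads to \<open>lower\<close> at -x/t.\<close>
    consider "t = 0" | "t > 0" | "t < 0" by linarith
    then show ?thesis
    proof cases
      case 1
      then show ?thesis using D(5)[OF xr] x z by simp
    next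
      case 2
      have "vadd X x (vscale X (of_real t) z)
          = vscale X (of_real t) (vadd X (vscale X (of_real (1/t)) x) z)"
        using 2 x z by (simp add: scale_add_right flip: of_real_mult)
      then have "vnorm X (vadd X x (vscale X (of_real t) z))
          = t * vnorm X (vadd X (vscale X (of_real (1/t)) x) z)"
        using 2 x z by simp
      moreover have "t * c \<le> t * (?p (vadd X (vscale X (of_real (1/t)) x) z) - (1/t) * r)"
        using upper[OF D(3)[OF xr, of "1/t"]] 2 by (intro mult_left_mono) auto
      ultimately show ?thesis using 2 by (simp add: algebra_simps)
    next
      case 3
      have "vadd X x (vscale X (of_real t) z)
          = vscale X (of_real (- t)) (vadd X (vscale X (of_real (- 1/t)) x) (vscale X (- 1) z))"
        using 3 x z by (simp add: scale_add_right flip: of_real_mult of_real_minus)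
      then have "vnorm X (vadd X x (vscale X (of_real t) z))
          = (- t) * vnorm X (vadd X (vscale X (of_real (- 1/t)) x) (vscale X (- 1) z))"
        using 3 x z by simp
      moreover have "(- t) * ((- 1/t) * r - ?p (vadd X (vscale X (of_real (- 1/t)) x) (vscale X (- 1) z)))
          \<le> (- t) * c"
        using lower[OF D(3)[OF xr, of "- 1/t"]] 3 by (intro mult_left_mono) auto
      ultimately show ?thesis using 3 by (simp add: algebra_simps)
    qed
  qed
  have "dominated_graph X K H"
    unfolding dominated_graph_def
  proof (intro conjI allI impI)
    show "(vzero X, 0) \<in> H"
      using HI[OF D(1), of 0] z by simp
  next
    fix x r y s assume "(x, r) \<in> H" "(y, s) \<in> H"
    then obtain x' r' t y' s' u where *: "(x', r') \<in> G" "(y', s') \<in> G"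
      "x = vadd X x' (vscale X (of_real t) z)" "r = r' + t * c"
      "y = vadd X y' (vscale X (of_real u) z)" "s = s' + u * c"
      unfolding H_def by blast
    have "vadd X x y = vadd X (vadd X x' y') (vscale X (of_real (t + u)) z)"
      using * D(4)[OF *(1)] D(4)[OF *(2)] z by (simp add: scale_add_left add_ac)
    then show "(vadd X x y, r + s) \<in> H"
      using HI[OF D(2)[OF *(1,2)], of "t + u"] * by (simp add: algebra_simps)
  next
    fix t x r assume "(x, r) \<in> H"
    then obtain x' r' u where *: "(x', r') \<in> G"
      "x = vadd X x' (vscale X (of_real u) z)" "r = r' + u * c"
      unfolding H_def by blast
    have "vscale X (of_real t) x = vadd X (vscale X (of_real t) x') (vscale X (of_real (t * u)) z)"
      using * D(4)[OF *(1)] z by (simp add: scale_add_right)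
    then show "(vscale X (of_real t) x, t * r) \<in> H"
      using HI[OF D(3)[OF *(1), of t], of "t * u"] * by (simp add: algebra_simps)
  next
    fix x r assume "(x, r) \<in> H"
    then show "x \<in> carr X" "r \<le> K * vnorm X x"
      using dom D(4) z by (auto simp: H_def)
  qed
  moreover have "G \<subseteq> H"
  proof clarify
    fix x r assume "(x, r) \<in> G"
    then show "(x, r) \<in> H"
      using HI[of x r 0] D(4)[of x r] z by simp
  qed
  moreover have "(z, c) \<in> H"
    using HI[OF D(1), of 1] z by simp
  ultimately show ?thesis by (rule that)
qed

text \<open>Zorn's lemma for the dominated graphs above G, ordered by inclusion. A maximal one is
  total, since otherwise \<open>dominated_graph_extend\<close> would enlarge it.\<close>

lemma (in seminormed_space) real_hahn_banach:
  assumes G: "dominated_graph X K G" and K: "0 \<le> K"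
  obtains u :: "'a \<Rightarrow> real" where
    "\<And>x y. x \<in> carr X \<Longrightarrow> y \<in> carr X \<Longrightarrow> u (vadd X x y) = u x + u y"
    "\<And>t x. x \<in> carr X \<Longrightarrow> u (vscale X (of_real t) x) = t * u x"
    "\<And>x. x \<in> carr X \<Longrightarrow> u x \<le> K * vnorm X x"
    "\<And>x r. (x, r) \<in> G \<Longrightarrow> u x = r"
proof -
  let ?S = "{H. dominated_graph X K H \<and> G \<subseteq> H}"
  have "\<exists>M\<in>?S. \<forall>H\<in>?S. M \<subseteq> H \<longrightarrow> H = M"
  proof (rule subset_Zorn_nonempty)
    show "?S \<noteq> {}" using G by auto
  next
    fix C assume ne: "C \<noteq> {}" and C: "subset.chain ?S C"
    have graph: "dominated_graph X K H" "G \<subseteq> H" if "H \<in> C" for H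
      using C that by (auto simp: subset.chain_def)
    note GD = dominated_graphD[OF graph(1)]
    have "dominated_graph X K (\<Union>C)"
      unfolding dominated_graph_def
    proof (intro conjI allI impI)
      show "(vzero X, 0) \<in> \<Union>C" using ne GD(1) by blast
    next
      fix x r y s assume "(x, r) \<in> \<Union>C" "(y, s) \<in> \<Union>C"
      then obtain H H' where H: "H \<in> C" "(x, r) \<in> H" "H' \<in> C" "(y, s) \<in> H'" by blast
      then have "H \<subseteq> H' \<or> H' \<subseteq> H"
        using C by (auto simp: subset_chain_def)
      then obtain H where "H \<in> C" "(x, r) \<in> H" "(y, s) \<in> H"
        using H by (metis subsetD)
      then have "(vadd X x y, r + s) \<in> H" by (metis GD(2))
      then show "(vadd X x y, r + s) \<in> \<Union>C" using \<open>H \<in> C\<close> by blast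
    next
      fix t x r assume "(x, r) \<in> \<Union>C"
      then show "(vscale X (of_real t) x, t * r) \<in> \<Union>C"
        using GD(3) by blast
    next
      fix x r assume "(x, r) \<in> \<Union>C"
      then show "x \<in> carr X" "r \<le> K * vnorm X x"
        using GD(4,5) by blast+
    qed
    then show "\<Union>C \<in> ?S" using ne graph by blast
  qed
  then obtain M where M: "dominated_graph X K M" "G \<subseteq> M"
    and "\<forall>H\<in>?S. M \<subseteq> H \<longrightarrow> H = M"
    by auto
  then have max: "H = M" if "dominated_graph X K H" "M \<subseteq> H" for H
    using that M(2) by blast
  note D = dominated_graphD[OF M(1)]
  have "\<exists>r. (x, r) \<in> M" if x: "x \<in> carr X" for x
  proof -
    obtain H c where "dominated_graph X K H" "M \<subseteq> H" "(x, c) \<in> H"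
      by (rule dominated_graph_extend[OF M(1) K x])
    then show ?thesis using max by blast
  qed
  then obtain u where u: "\<And>x. x \<in> carr X \<Longrightarrow> (x, u x) \<in> M" by metis
  have eq: "u x = r" if "(x, r) \<in> M" for x r
    using dominated_graph_unique[OF M(1) u that] D(4)[OF that] by simp
  show ?thesis
  proof (rule that[of u])
    show "u (vadd X x y) = u x + u y" if "x \<in> carr X" "y \<in> carr X" for x y
      by (rule eq) (use D(2) u that in auto)
    show "u (vscale X (of_real t) x) = t * u x" if "x \<in> carr X" for x t
      by (rule eq) (use D(3) u that in auto)
    show "u x \<le> K * vnorm X x" if "x \<in> carr X" for x
      using D(5) u that by blast
    show "u x = r" if "(x, r) \<in> G" for x r
      using eq that M(2) by blast
  qed
qed

text \<open>One interface for both fields: j is an imaginary unit, or 0 over the reals. In the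
  complex case \<open>re (j * x)\<close> is minus the imaginary part, so that a scalar is recovered
  from real parts alone.\<close>

lemma rc_field_real_part:
  obtains re :: "'k::rc_field \<Rightarrow> real" and j :: 'k where
    "\<And>x y. re (x + y) = re x + re y"
    "\<And>a x. re (of_real a * x) = a * re x"
    "\<And>a. re (of_real a) = a"
    "\<And>x. re x \<le> norm x"
    "\<And>x. x = of_real (re x) - j * of_real (re (j * x))"
    "j = 0 \<or> j * j = - 1"
proof -
  consider (real) "\<forall>x::'k. \<exists>a. x = of_real a"
    | (complex) i :: 'k where "i * i = - 1"
        "\<forall>x. \<exists>a b. x = of_real a + of_real b * i \<and> norm x = sqrt (a\<^sup>2 + b\<^sup>2)"
    using real_or_complex[where 'a = 'k] by (auto simp: of_real_def)
  then show thesis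
  proof cases
    case real
    then obtain re where re: "x = of_real (re x)" for x :: 'k by metis
    show thesis
    proof (rule that[of re 0])
      fix x y :: 'k and a :: real
      show "re (x + y) = re x + re y"
        using re[of "x + y"] re[of x] re[of y] by (metis of_real_add of_real_eq_iff)
      show "re (of_real a * x) = a * re x"
        using re[of "of_real a * x"] re[of x] by (metis of_real_mult of_real_eq_iff)
      show "re (of_real a) = a"
        using re[of "of_real a"] by simp
      show "re x \<le> norm x"
        using re[of x] by (metis abs_ge_self norm_of_real)
      show "x = of_real (re x) - 0 * of_real (re (0 * x))"
        using re by simp
    qed simp
  next
    case complex
    then obtain re im where ri: "x = of_real (re x) + of_real (im x) * i"
      and n: "norm x = sqrt ((re x)\<^sup>2 + (im x)\<^sup>2)" for x
      by metis
    \<comment> \<open>1 and i are linearly independent over the reals: a dependence would make i a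
      real t with \<open>t * t = - 1\<close>.\<close>
    have uniq: "a = a' \<and> b = b'"
      if eq: "of_real a + of_real b * i = of_real a' + of_real b' * i" for a b a' b'
    proof (rule ccontr)
      assume ne: "\<not> (a = a' \<and> b = b')"
      then have "b \<noteq> b'" using eq by auto
      define t where "t = (a' - a) / (b - b')"
      have "of_real (b - b') * i = of_real (a' - a)"
        using eq by (simp add: algebra_simps)
      then have "i = of_real t"
        using \<open>b \<noteq> b'\<close> by (simp add: t_def field_simps)
      then have "of_real (t * t) = (of_real (- 1) :: 'k)"
        using complex(1) by simp
      then have "t * t = - 1" by (simp only: of_real_eq_iff)
      then show False using zero_le_square[of t] by linarith
    qed
    have re_eq: "re x = a" if "x = of_real a + of_real b * i" for x a b
      using uniq ri[of x] that by metis
    show thesis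
    proof (rule that[of re i])
      fix x y :: 'k and a :: real
      show "re (x + y) = re x + re y"
        by (rule re_eq[of _ _ "im x + im y"]) (subst ri[of x], subst ri[of y], simp add: algebra_simps)
      show "re (of_real a * x) = a * re x"
        by (rule re_eq[of _ _ "a * im x"]) (subst ri[of x], simp add: algebra_simps)
      show "re (of_real a) = a"
        by (rule re_eq[of _ _ 0]) simp
      show "re x \<le> norm x"
        unfolding n by (rule real_le_rsqrt) simp
      have "re (i * x) = - im x"
      proof (rule re_eq[of _ _ "re x"])
        have "i * x = of_real (re x) * i + of_real (im x) * (i * i)"
          by (subst ri[of x]) (simp add: algebra_simps)
        then show "i * x = of_real (- im x) + of_real (re x) * i"
          using complex(1) by simp
      qed
      then show "x = of_real (re x) - i * of_real (re (i * x))"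
        using ri[of x] by (simp add: mult.commute)
    qed (use complex(1) in simp)
  qed
qed

text \<open>Complexification: the real part of the functional with graph G is extended to u, and
  \<open>F x = u x - j * u (j x)\<close> is the scalar-linear functional with real part u. Over the
  reals j is 0 and F is u.\<close>

theorem hahn_banach_graph:
  fixes X :: "('k::rc_field, 'a) nspace"
  assumes "seminormed_space X" and K: "0 \<le> K" and zero: "(vzero X, 0) \<in> G"
    and add: "\<And>x r y s. (x, r) \<in> G \<Longrightarrow> (y, s) \<in> G \<Longrightarrow> (vadd X x y, r + s) \<in> G"
    and scale: "\<And>c x r. (x, r) \<in> G \<Longrightarrow> (vscale X c x, c * r) \<in> G"
    and G: "\<And>x r. (x, r) \<in> G \<Longrightarrow> x \<in> carr X"
    and dom: "\<And>x r. (x, r) \<in> G \<Longrightarrow> norm r \<le> K * vnorm X x"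
  obtains F where "F \<in> carr (dual X)" "\<And>x r. (x, r) \<in> G \<Longrightarrow> F x = r" "vnorm (dual X) F \<le> K"
proof -
  interpret seminormed_space X by fact
  obtain re :: "'k \<Rightarrow> real" and j :: 'k where re_add: "\<And>x y. re (x + y) = re x + re y"
    and re_scale: "\<And>a x. re (of_real a * x) = a * re x" and re_of_real: "\<And>a. re (of_real a) = a"
    and re_le: "\<And>x. re x \<le> norm x"
    and split: "\<And>x. x = of_real (re x) - j * of_real (re (j * x))"
    and j: "j = 0 \<or> j * j = - 1"
    by (rule rc_field_real_part) blast
  have re_zero: "re 0 = 0" using re_of_real[of 0] by simp
  \<comment> \<open>The decomposition of 1 leaves \<open>j * of_real (re j) = 0\<close>.\<close>
  have re_j: "re j = 0"
    using split[of 1] re_of_real[of 1] re_zero by (cases "j = 0") auto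
  let ?H = "{(x, re r) | x r. (x, r) \<in> G}"
  have "dominated_graph X K ?H"
    unfolding dominated_graph_def
  proof (intro conjI allI impI)
    show "(vzero X, 0) \<in> ?H" using zero re_zero by force
  next
    fix x a y b assume "(x, a) \<in> ?H" "(y, b) \<in> ?H"
    then obtain r s where "(x, r) \<in> G" "a = re r" "(y, s) \<in> G" "b = re s" by auto
    then show "(vadd X x y, a + b) \<in> ?H"
      using add[of x r y s] re_add[of r s] by force
  next
    fix t x a assume "(x, a) \<in> ?H"
    then obtain r where "(x, r) \<in> G" "a = re r" by auto
    then show "(vscale X (of_real t) x, t * a) \<in> ?H"
      using scale[of x r "of_real t"] re_scale[of t r] by force
  next
    fix x a assume "(x, a) \<in> ?H"
    then obtain r where "(x, r) \<in> G" "a = re r" by auto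
    then show "x \<in> carr X" "a \<le> K * vnorm X x"
      using G dom[of x r] re_le[of r] by auto
  qed
  from real_hahn_banach[OF this K] obtain u where
    u_add: "\<And>x y. x \<in> carr X \<Longrightarrow> y \<in> carr X \<Longrightarrow> u (vadd X x y) = u x + u y"
    and u_scale: "\<And>t x. x \<in> carr X \<Longrightarrow> u (vscale X (of_real t) x) = t * u x"
    and u_le: "\<And>x. x \<in> carr X \<Longrightarrow> u x \<le> K * vnorm X x"
    and u_G: "\<And>x r. (x, r) \<in> ?H \<Longrightarrow> u x = r"
    by blast
  define F where "F = (\<lambda>x\<in>carr X. of_real (u x) - j * of_real (u (vscale X j x)))"
  have F_add: "F (vadd X x y) = F x + F y" if "x \<in> carr X" "y \<in> carr X" for x y
    using that by (simp add: F_def u_add scale_add_right algebra_simps)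
  have u_zero: "u (vzero X) = 0"
    using u_scale[of "vzero X" 0] by simp
  have F_scale: "F (vscale X c x) = c * F x" if x: "x \<in> carr X" for c x
  proof -
    define a b where "a = re c" and "b = - re (j * c)"
    have c: "c = of_real a + of_real b * j"
      using split[of c] by (simp add: a_def b_def mult.commute)
    have jx: "vscale X j x \<in> carr X" using x by simp
    have ucx: "u (vscale X c x) = a * u x + b * u (vscale X j x)"
      using u_scale[OF x, of a] u_scale[OF jx, of b] x by (simp add: c scale_add_left u_add)
    from j show ?thesis
    proof
      assume "j = 0"
      then show ?thesis using ucx x c by (simp add: F_def u_zero)
    next
      assume jj: "j * j = - 1"
      have jj': "j * (j * z) = - z" for z
        using jj by (simp flip: mult.assoc)
      have "j * c = of_real (- b) + of_real a * j"
        by (simp add: c algebra_simps jj')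
      then have "vscale X j (vscale X c x)
          = vadd X (vscale X (of_real (- b)) x) (vscale X (of_real a) (vscale X j x))"
        using x scale_add_left[OF x, of "of_real (- b)" "of_real a * j"] by simp
      then have ujcx: "u (vscale X j (vscale X c x)) = a * u (vscale X j x) - b * u x"
        using u_scale[OF x, of "- b"] u_scale[OF jx, of a] x by (simp add: u_add)
      have "F (vscale X c x)
          = of_real (a * u x + b * u (vscale X j x)) - j * of_real (a * u (vscale X j x) - b * u x)"
        unfolding F_def restrict_apply using x by (simp only: ucx ujcx if_True scale_closed)
      also have "\<dots> = c * F x"
        using x by (simp add: F_def c algebra_simps jj')
      finally show ?thesis .
    qed
  qed
  have re_F: "re (F x) = u x" if "x \<in> carr X" for x
  proof -
    have "re (F x) = re (of_real (u x) + of_real (- u (vscale X j x)) * j)"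
      using that by (simp add: F_def mult.commute)
    then show ?thesis unfolding re_add re_scale re_of_real re_j by simp
  qed
  have bd: "norm (F x) \<le> K * vnorm X x" if x: "x \<in> carr X" for x
  proof (cases "F x = 0")
    case True
    then show ?thesis using K x by simp
  next
    case False
    \<comment> \<open>This scalar of modulus 1 turns \<open>F x\<close> into its modulus, so the
      bound on the real part u bounds the norm of \<open>F x\<close>.\<close>
    define c where "c = of_real (norm (F x)) / F x"
    have "F (vscale X c x) = of_real (norm (F x))"
      using False F_scale[OF x] by (simp add: c_def)
    then have "norm (F x) = u (vscale X c x)"
      using re_F[of "vscale X c x"] x re_of_real by simp
    also have "\<dots> \<le> K * vnorm X (vscale X c x)"
      using x by (intro u_le) simp
    also have "\<dots> = K * vnorm X x"
      using False x by (simp add: c_def norm_divide)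
    finally show ?thesis .
  qed
  show ?thesis
  proof (rule that)
    have "F \<in> extensional (carr X)"
      unfolding F_def by (rule restrict_extensional)
    then show "F \<in> carr (dual X)"
      by (rule dualI[OF _ F_add F_scale bd])
    show "vnorm (dual X) F \<le> K" by (rule dual_norm_le[OF bd K])
    fix x r assume xr: "(x, r) \<in> G"
    have "u x = re r" "u (vscale X j x) = re (j * r)"
      using u_G xr scale[OF xr, of j] by blast+
    then show "F x = r"
      using split[of r] G[OF xr] by (simp add: F_def)
  qed
qed

subsection \<open>Bounded operators and their conjugates\<close>

lemma bounded_opD:
  assumes "bounded_op X Y T"
  shows "\<And>x. x \<in> carr X \<Longrightarrow> T x \<in> carr Y"
    "\<And>x y. x \<in> carr X \<Longrightarrow> y \<in> carr X \<Longrightarrow> T (vadd X x y) = vadd Y (T x) (T y)"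
    "\<And>c x. x \<in> carr X \<Longrightarrow> T (vscale X c x) = vscale Y c (T x)"
  using assms by (auto simp: bounded_op_def)

lemma bounded_op_bound:
  assumes "bounded_op X Y T" and X: "seminormed_space X"
  obtains K where "0 \<le> K" "\<And>x. x \<in> carr X \<Longrightarrow> vnorm Y (T x) \<le> K * vnorm X x"
proof -
  obtain K where K: "\<forall>x\<in>carr X. vnorm Y (T x) \<le> K * vnorm X x"
    using assms by (auto simp: bounded_op_def)
  have "vnorm Y (T x) \<le> \<bar>K\<bar> * vnorm X x" if "x \<in> carr X" for x
  proof -
    have "K * vnorm X x \<le> \<bar>K\<bar> * vnorm X x"
      using seminormed_space.norm_nonneg[OF X that] by (intro mult_right_mono) auto
    then show ?thesis using K that by force
  qed
  then show ?thesis using that[of "\<bar>K\<bar>"] by simp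
qed

lemma bounded_opI:
  assumes "\<And>x. x \<in> carr X \<Longrightarrow> T x \<in> carr Y"
    "\<And>x y. x \<in> carr X \<Longrightarrow> y \<in> carr X \<Longrightarrow> T (vadd X x y) = vadd Y (T x) (T y)"
    "\<And>c x. x \<in> carr X \<Longrightarrow> T (vscale X c x) = vscale Y c (T x)"
    "\<And>x. x \<in> carr X \<Longrightarrow> vnorm Y (T x) \<le> K * vnorm X x"
  shows "bounded_op X Y T"
  unfolding bounded_op_def using assms by blast

lemma bounded_op_zero:
  assumes "bounded_op X Y T" "seminormed_space X" "seminormed_space Y"
  shows "T (vzero X) = vzero Y"
proof -
  interpret X: seminormed_space X by fact
  interpret Y: seminormed_space Y by fact
  show ?thesis
    using bounded_opD(3)[OF assms(1) X.zero_closed, of 0] bounded_opD(1)[OF assms(1) X.zero_closed]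
    by simp
qed

text \<open>S is compared with the composite on the carrier only, which fits \<open>pair_op\<close>,
  whose inclusion is a restricted function.\<close>

lemma bounded_op_comp:
  assumes T: "bounded_op X Y T" and U: "bounded_op Y W U"
    and X: "seminormed_space X" and Y: "seminormed_space Y"
    and S: "\<And>x. x \<in> carr X \<Longrightarrow> S x = U (T x)"
  shows "bounded_op X W S"
proof -
  interpret X: seminormed_space X by fact
  obtain K where K: "0 \<le> K" "\<And>x. x \<in> carr X \<Longrightarrow> vnorm Y (T x) \<le> K * vnorm X x"
    by (rule bounded_op_bound[OF T X]) blast
  obtain L where L: "0 \<le> L" "\<And>x. x \<in> carr Y \<Longrightarrow> vnorm W (U x) \<le> L * vnorm Y x"
    by (rule bounded_op_bound[OF U Y]) blast
  have "vnorm W (S x) \<le> (L * K) * vnorm X x" if "x \<in> carr X" for x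
    using L(2)[OF bounded_opD(1)[OF T that]] mult_left_mono[OF K(2)[OF that] L(1)] S[OF that]
    by (simp add: mult.assoc)
  then show ?thesis
    by (intro bounded_opI) (simp_all add: S bounded_opD[OF T] bounded_opD[OF U])
qed

section \<open>Conjugate operators\<close>

lemma conj_op_apply [simp]: "x \<in> carr X \<Longrightarrow> conj_op X T g x = g (T x)"
  by (simp add: conj_op_def)

text \<open>One estimate with two readings: for fixed g it bounds the functional
  \<open>conj_op X T g\<close>, and as g varies it bounds the conjugate operator.\<close>

lemma conj_op_bound:
  assumes T: "bounded_op X Y T" and X: "seminormed_space X" and Y: "seminormed_space Y"
    and K: "0 \<le> K" "\<And>x. x \<in> carr X \<Longrightarrow> vnorm Y (T x) \<le> K * vnorm X x"
    and g: "g \<in> carr (dual Y)" and x: "x \<in> carr X"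
  shows "norm (conj_op X T g x) \<le> (K * vnorm (dual Y) g) * vnorm X x"
proof -
  interpret Y: seminormed_space Y by fact
  have "norm (g (T x)) \<le> vnorm (dual Y) g * vnorm Y (T x)"
    by (intro Y.norm_le_dual_norm g bounded_opD(1)[OF T x])
  also have "\<dots> \<le> vnorm (dual Y) g * (K * vnorm X x)"
    by (intro mult_left_mono K x Y.dual_norm_nonneg g)
  finally show ?thesis using x by (simp add: mult_ac)
qed

lemma conj_op_closed:
  assumes T: "bounded_op X Y T" and X: "seminormed_space X" and Y: "seminormed_space Y"
    and g: "g \<in> carr (dual Y)"
  shows "conj_op X T g \<in> carr (dual X)"
proof -
  interpret X: seminormed_space X by fact
  obtain K where K: "0 \<le> K" "\<And>x. x \<in> carr X \<Longrightarrow> vnorm Y (T x) \<le> K * vnorm X x"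
    by (rule bounded_op_bound[OF T X]) blast
  have "conj_op X T g \<in> extensional (carr X)"
    by (simp add: conj_op_def)
  then show ?thesis
    by (rule dualI[OF _ _ _ conj_op_bound[OF T X Y K g]])
      (simp_all add: bounded_opD[OF T] dualD(2,3)[OF g])
qed

lemma bounded_op_conj_op:
  assumes T: "bounded_op X Y T" and X: "seminormed_space X" and Y: "seminormed_space Y"
  shows "bounded_op (dual Y) (dual X) (conj_op X T)"
proof -
  interpret X: seminormed_space X by fact
  interpret Y: seminormed_space Y by fact
  obtain K where K: "0 \<le> K" "\<And>x. x \<in> carr X \<Longrightarrow> vnorm Y (T x) \<le> K * vnorm X x"
    by (rule bounded_op_bound[OF T X]) blast
  note closed = conj_op_closed[OF T X Y]
  show ?thesis
  proof (rule bounded_opI[of _ _ _ K])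
    show "conj_op X T g \<in> carr (dual X)" if "g \<in> carr (dual Y)" for g
      by (rule closed[OF that])
    show "vnorm (dual X) (conj_op X T g) \<le> K * vnorm (dual Y) g" if "g \<in> carr (dual Y)" for g
      by (intro X.dual_norm_le conj_op_bound[OF T X Y K that] mult_nonneg_nonneg K(1)
        Y.dual_norm_nonneg that)
    show "conj_op X T (vadd (dual Y) g h) = vadd (dual X) (conj_op X T g) (conj_op X T h)"
      if "g \<in> carr (dual Y)" "h \<in> carr (dual Y)" for g h
      by (rule dual_eqI[OF closed[OF Y.add_dual(1)] X.add_dual(1)])
        (simp_all add: that closed bounded_opD(1)[OF T])
    show "conj_op X T (vscale (dual Y) c g) = vscale (dual X) c (conj_op X T g)"
      if "g \<in> carr (dual Y)" for c g
      by (rule dual_eqI[OF closed[OF Y.scale_dual(1)] X.scale_dual(1)])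
        (simp_all add: that closed bounded_opD(1)[OF T])
  qed
qed

section \<open>The canonical embedding into the bidual\<close>

lemma canon_apply [simp]: "f \<in> carr (dual X) \<Longrightarrow> canon X x f = f x"
  by (simp add: canon_def)

lemma bounded_op_canon:
  assumes X: "seminormed_space X"
  shows "bounded_op X (bidual X) (canon X)"
proof -
  interpret X: seminormed_space X by fact
  interpret X': seminormed_space "dual X" by (rule X.seminormed_dual)
  have bd: "norm (canon X x f) \<le> vnorm X x * vnorm (dual X) f"
    if "x \<in> carr X" "f \<in> carr (dual X)" for x f
    using X.norm_le_dual_norm[OF that(2,1)] that(2) by (simp add: mult.commute)
  have closed: "canon X x \<in> carr (bidual X)" if "x \<in> carr X" for x
  proof (rule dualI[OF _ _ _ bd[OF that]])
    show "canon X x \<in> extensional (carr (dual X))" unfolding canon_def by (rule restrict_extensional)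
  qed (simp_all add: that)
  show ?thesis
  proof (rule bounded_opI[of _ _ _ 1])
    show "vnorm (bidual X) (canon X x) \<le> 1 * vnorm X x" if "x \<in> carr X" for x
      using X'.dual_norm_le[OF bd] that by simp
    show "canon X (vadd X x y) = vadd (bidual X) (canon X x) (canon X y)"
      if "x \<in> carr X" "y \<in> carr X" for x y
      by (rule dual_eqI[OF closed X'.add_dual(1)]) (simp_all add: that closed dualD(2))
    show "canon X (vscale X c x) = vscale (bidual X) c (canon X x)" if "x \<in> carr X" for c x
      by (rule dual_eqI[OF closed X'.scale_dual(1)]) (simp_all add: that closed dualD(3))
  qed (rule closed)
qed

section \<open>Functionals on quotients\<close>

lemma (in seminormed_quotient) bounded_op_qmap: "bounded_op V (quot_space V A) (qmap V A)"
  by (rule bounded_opI[of _ _ _ 1]) (simp_all add: vadd_quot vscale_quot norm_quot_le_norm)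

text \<open>A bound for f holds at every representative of a coset and so passes to the infimum.
  This yields, with control of norms, the identification of the dual of V/A with the annihilator of
  A.\<close>

lemma (in seminormed_quotient) factor_qmap:
  assumes f: "f \<in> annihilator V A"
  obtains g where "g \<in> carr (dual (quot_space V A))" "\<And>x. x \<in> carr V \<Longrightarrow> g (qmap V A x) = f x"
    "vnorm (dual (quot_space V A)) g \<le> vnorm (dual V) f"
proof -
  interpret Q: seminormed_space "quot_space V A" by (rule seminormed_quot)
  have fV: "f \<in> carr (dual V)" and fA: "\<And>a. a \<in> A \<Longrightarrow> f a = 0"
    using f by (auto simp: annihilator_def)
  let ?n = "vnorm (dual V) f"
  have n: "0 \<le> ?n" by (rule dual_norm_nonneg[OF fV])
  \<comment> \<open>A coset is evaluated at a chosen representative; as f vanishes on A, the choice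
    does not matter.\<close>
  define g where
    "g = (\<lambda>C\<in>carr (quot_space V A). f (SOME x. x \<in> carr V \<and> qmap V A x = C))"
  have g: "g (qmap V A x) = f x" if x: "x \<in> carr V" for x
  proof -
    have "\<exists>y. y \<in> carr V \<and> qmap V A y = qmap V A x" using x by blast
    from someI_ex[OF this] obtain a where "a \<in> A"
      "(SOME y. y \<in> carr V \<and> qmap V A y = qmap V A x) = vadd V x a"
      by (metis qmap_eqE)
    then show ?thesis using x fA dualD(2)[OF fV, of x a] by (simp add: g_def)
  qed
  have bd: "norm (g C) \<le> ?n * vnorm (quot_space V A) C" if C: "C \<in> carr (quot_space V A)" for C
  proof -
    obtain x where x: "x \<in> carr V" "C = qmap V A x" using C by auto
    have *: "norm (f x) \<le> ?n * vnorm V (vadd V x a)" if "a \<in> A" for a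
      using norm_le_dual_norm[OF fV, of "vadd V x a"] dualD(2)[OF fV, of x a] fA[OF that] x that
      by simp
    show ?thesis
    proof (cases "?n = 0")
      case True
      then show ?thesis using *[of "vzero V"] x g by simp
    next
      case False
      have "norm (f x) / ?n \<le> vnorm (quot_space V A) C"
        unfolding x(2)
        by (rule norm_quot_greatest[OF x(1)]) (use * False n in \<open>simp add: field_simps\<close>)
      then show ?thesis using False n x g by (simp add: field_simps)
    qed
  qed
  have "g \<in> carr (dual (quot_space V A))"
  proof (rule dualI[OF _ _ _ bd])
    show "g \<in> extensional (carr (quot_space V A))" by (simp add: g_def)
    show "g (vadd (quot_space V A) C D) = g C + g D"
      if "C \<in> carr (quot_space V A)" "D \<in> carr (quot_space V A)" for C D
      using that g by (auto simp: vadd_quot dualD(2)[OF fV])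
    show "g (vscale (quot_space V A) c C) = c * g C" if "C \<in> carr (quot_space V A)" for c C
      using that g by (auto simp: vscale_quot dualD(3)[OF fV])
  qed
  moreover have "vnorm (dual (quot_space V A)) g \<le> ?n"
    by (rule Q.dual_norm_le[OF bd n])
  ultimately show ?thesis using that g by blast
qed

section \<open>Extension of functionals and density\<close>

text \<open>Hahn-Banach for g transported through i. The estimate with C makes the relation between
  \<open>i x\<close> and \<open>g x\<close> dominated, hence a functional on the range of i. It is
  used for inclusions and for an isomorphism onto an annihilator.\<close>

lemma extend_along:
  fixes X :: "('k::rc_field, 'a) nspace" and V :: "('k, 'b) nspace"
  assumes X: "seminormed_space X" and V: "seminormed_space V" and i: "bounded_op X V i"
    and C: "0 \<le> C" "\<And>x. x \<in> carr X \<Longrightarrow> vnorm X x \<le> C * vnorm V (i x)"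
    and g: "g \<in> carr (dual X)"
  obtains f where "f \<in> carr (dual V)" "\<And>x. x \<in> carr X \<Longrightarrow> f (i x) = g x"
    "vnorm (dual V) f \<le> C * vnorm (dual X) g"
proof -
  interpret X: seminormed_space X by fact
  interpret V: seminormed_space V by fact
  have i_rules: "i x \<in> carr V" "i (vscale X c x) = vscale V c (i x)" if "x \<in> carr X" for x c
    using i that by (auto simp: bounded_op_def)
  have i_add: "i (vadd X x y) = vadd V (i x) (i y)" if "x \<in> carr X" "y \<in> carr X" for x y
    using i that by (auto simp: bounded_op_def)
  let ?G = "{(i x, g x) | x. x \<in> carr X}"
  have "\<exists>f\<in>carr (dual V). (\<forall>x r. (x, r) \<in> ?G \<longrightarrow> f x = r) \<and> vnorm (dual V) f \<le> C * vnorm (dual X) g"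
  proof (rule hahn_banach_graph[OF V, of "C * vnorm (dual X) g" ?G])
    show "0 \<le> C * vnorm (dual X) g"
      using C(1) X.dual_norm_nonneg[OF g] by simp
    show "(vzero V, 0) \<in> ?G"
      using i_rules(1)[OF X.zero_closed] i_rules(2)[OF X.zero_closed, of 0] X.dual_zero[OF g] by force
  next
    fix x r y s assume "(x, r) \<in> ?G" "(y, s) \<in> ?G"
    then show "(vadd V x y, r + s) \<in> ?G"
      using i_add dualD(2)[OF g] X.add_closed by (smt (verit) mem_Collect_eq prod.inject)
  next
    fix c x r assume "(x, r) \<in> ?G"
    then show "(vscale V c x, c * r) \<in> ?G"
      using i_rules(2) dualD(3)[OF g] X.scale_closed by (smt (verit) mem_Collect_eq prod.inject)
  next
    fix x r assume "(x, r) \<in> ?G"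
    then obtain y where y: "y \<in> carr X" "x = i y" "r = g y" by auto
    then show "x \<in> carr V" using i_rules(1) by simp
    have "norm (g y) \<le> vnorm (dual X) g * vnorm X y"
      by (rule X.norm_le_dual_norm[OF g y(1)])
    also have "\<dots> \<le> vnorm (dual X) g * (C * vnorm V (i y))"
      by (intro mult_left_mono C(2) y X.dual_norm_nonneg[OF g])
    finally show "norm r \<le> C * vnorm (dual X) g * vnorm V x"
      using y by (simp add: mult.left_commute mult.assoc)
  qed blast
  then show ?thesis using that by blast
qed

text \<open>A bounded functional that vanishes on a dense set is 0. Conversely, if x had positive
  distance p from D, a functional on V/D with value p at the coset of x would pull back to a nonzero
  functional annihilating D.\<close>

lemma dense_in_iff_annihilator:
  fixes V :: "('k::rc_field, 'a) nspace"
  assumes V: "seminormed_space V" and D: "lin_subspace V D"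
  shows "dense_in V D \<longleftrightarrow> annihilator V D \<subseteq> {vzero (dual V)}"
proof
  interpret seminormed_space V by fact
  note D_rules = lin_subspaceD[OF D]
  assume dense: "dense_in V D"
  show "annihilator V D \<subseteq> {vzero (dual V)}"
  proof
    fix f assume "f \<in> annihilator V D"
    then have f: "f \<in> carr (dual V)" "\<And>d. d \<in> D \<Longrightarrow> f d = 0"
      by (auto simp: annihilator_def)
    let ?n = "vnorm (dual V) f"
    have "f x = 0" if x: "x \<in> carr V" for x
    proof (rule ccontr)
      assume "f x \<noteq> 0"
      have n: "0 \<le> ?n" by (rule dual_norm_nonneg[OF f(1)])
      \<comment> \<open>The summand 1 keeps the denominator positive and makes \<open>?n * e\<close>
        strictly smaller than \<open>norm (f x)\<close>.\<close>
      define e where "e = norm (f x) / (?n + 1)"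
      have "e > 0" using \<open>f x \<noteq> 0\<close> n by (simp add: e_def)
      then obtain d where d: "d \<in> D" "ndist V x d < e"
        using dense x unfolding dense_in_def by blast
      then have "d \<in> carr V" "vnorm V (vadd V x (vscale V (- 1) d)) < e"
        using D_rules(2) x by (auto simp: ndist_def)
      moreover have "norm (f x) \<le> ?n * vnorm V (vadd V x (vscale V (- 1) d))"
        using norm_le_dual_norm[OF f(1), of "vadd V x (vscale V (- 1) d)"] x
          \<open>d \<in> carr V\<close> f(2)[OF d(1)] by (simp add: dualD[OF f(1)])
      ultimately have "norm (f x) \<le> ?n * e"
        using n by (meson less_imp_le mult_left_mono order_trans)
      also have "\<dots> < (?n + 1) * e" using \<open>e > 0\<close> by simp
      also have "\<dots> = norm (f x)" using n by (simp add: e_def)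
      finally show False by simp
    qed
    then show "f \<in> {vzero (dual V)}"
      using dual_eqI[OF f(1) zero_dual] by simp
  qed
next
  interpret seminormed_quotient V D
    using V D by (intro seminormed_quotient.intro seminormed_quotient_axioms.intro)
  let ?Q = "quot_space V D"
  interpret Q: seminormed_space ?Q by (rule seminormed_quot)
  assume ann: "annihilator V D \<subseteq> {vzero (dual V)}"
  show "dense_in V D"
    unfolding dense_in_def
  proof (intro conjI ballI allI impI)
    show "D \<subseteq> carr V" using lin_subspaceD(1)[OF D] .
    fix x e assume x: "x \<in> carr V" and e: "(0::real) < e"
    \<comment> \<open>\<open>?p\<close> is the distance from x to D, and \<open>?G\<close> is the
      graph of the functional with value \<open>c * ?p\<close> at the coset of \<open>c x\<close>,
      on the line spanned by the coset of x. It is dominated with constant 1.\<close>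
    let ?p = "vnorm ?Q (qmap V D x)"
    let ?G = "{(qmap V D (vscale V c x), c * of_real ?p) | c. True}"
    have p: "?p \<ge> 0" by (rule norm_quot_nonneg[OF x])
    have "\<exists>g\<in>carr (dual ?Q). \<forall>y r. (y, r) \<in> ?G \<longrightarrow> g y = r"
    proof (rule hahn_banach_graph[OF seminormed_quot, of 1 ?G])
      show "(vzero ?Q, 0) \<in> ?G"
        using x qmap_zero by (force intro: exI[of _ 0])
    next
      fix y r z s assume "(y, r) \<in> ?G" "(z, s) \<in> ?G"
      then obtain c d where "y = qmap V D (vscale V c x)" "r = c * of_real ?p"
        "z = qmap V D (vscale V d x)" "s = d * of_real ?p" by auto
      then show "(vadd ?Q y z, r + s) \<in> ?G"
        using x by (auto simp: vadd_quot scale_add_left distrib_right intro!: exI[of _ "c + d"])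
    next
      fix c y r assume "(y, r) \<in> ?G"
      then obtain d where "y = qmap V D (vscale V d x)" "r = d * of_real ?p" by auto
      then show "(vscale ?Q c y, c * r) \<in> ?G"
        using x by (auto simp: vscale_quot mult.assoc intro!: exI[of _ "c * d"])
    next
      fix y r assume "(y, r) \<in> ?G"
      then obtain c where c: "y = qmap V D (vscale V c x)" "r = c * of_real ?p" by auto
      then show "y \<in> carr ?Q" using x by simp
      have "vnorm ?Q y = norm c * ?p"
        using Q.norm_scale[of "qmap V D x" c] x c by (simp add: vscale_quot)
      then show "norm r \<le> 1 * vnorm ?Q y"
        using c p by (simp add: norm_mult)
    qed auto
    then obtain g where g: "g \<in> carr (dual ?Q)" and gG: "\<And>y r. (y, r) \<in> ?G \<Longrightarrow> g y = r"
      by blast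
    define f where "f = conj_op V (qmap V D) g"
    have "f \<in> carr (dual V)"
      unfolding f_def by (rule conj_op_closed[OF bounded_op_qmap V seminormed_quot g])
    moreover have "f d = 0" if "d \<in> D" for d
      using that Q.dual_zero[OF g] by (simp add: f_def qmap_of_mem)
    ultimately have "f = vzero (dual V)"
      using ann by (auto simp: annihilator_def)
    then have "conj_op V (qmap V D) g x = 0"
      using x by (simp add: f_def)
    then have "g (qmap V D x) = 0"
      using x by simp
    moreover have "g (qmap V D x) = of_real ?p"
      by (rule gG) (use x in \<open>force intro: exI[of _ 1]\<close>)
    ultimately have "?p < e" using e by simp
    then obtain a where a: "a \<in> D" "vnorm V (vadd V x a) < e"
      by (rule norm_quot_less[OF x])
    then show "\<exists>d\<in>D. ndist V x d < e"
      using x by (intro bexI[of _ "vscale V (- 1) a"]) (auto simp: ndist_def)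
  qed
qed

section \<open>Annihilators\<close>

lemma annihilatorD:
  assumes "f \<in> annihilator V A"
  shows "f \<in> carr (dual V)" "\<And>x. x \<in> A \<Longrightarrow> f x = 0"
  using assms by (auto simp: annihilator_def)

lemma annihilatorI:
  "f \<in> carr (dual V) \<Longrightarrow> (\<And>x. x \<in> A \<Longrightarrow> f x = 0) \<Longrightarrow> f \<in> annihilator V A"
  by (auto simp: annihilator_def)

lemma (in seminormed_space) lin_subspace_annihilator:
  assumes "A \<subseteq> carr X"
  shows "lin_subspace (dual X) (annihilator X A)"
  unfolding lin_subspace_def
proof (intro conjI ballI allI)
  show "annihilator X A \<subseteq> carr (dual X)" by (auto simp: annihilator_def)
  show "vzero (dual X) \<in> annihilator X A"
    using assms by (intro annihilatorI zero_dual) auto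
  show "vadd (dual X) f g \<in> annihilator X A" if "f \<in> annihilator X A" "g \<in> annihilator X A" for f g
  proof (rule annihilatorI)
    show "vadd (dual X) f g \<in> carr (dual X)" using that by (intro add_dual annihilatorD)
    show "vadd (dual X) f g x = 0" if "x \<in> A" for x
      using \<open>f \<in> _\<close> \<open>g \<in> _\<close> that assms by (auto simp: annihilatorD(2))
  qed
  show "vscale (dual X) c f \<in> annihilator X A" if "f \<in> annihilator X A" for c f
  proof (rule annihilatorI)
    show "vscale (dual X) c f \<in> carr (dual X)" using that by (intro scale_dual annihilatorD)
    show "vscale (dual X) c f x = 0" if "x \<in> A" for x
      using \<open>f \<in> _\<close> that assms by (auto simp: annihilatorD(2))
  qed
qed

text \<open>Evaluation at a point is continuous on the dual: if f is nonzero at some x in A, then so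
  are all functionals close to f.\<close>

lemma (in seminormed_space) closed_subspace_annihilator:
  assumes A: "A \<subseteq> carr X"
  shows "closed_subspace (dual X) (annihilator X A)"
proof -
  interpret D: seminormed_space "dual X" by (rule seminormed_dual)
  interpret M: Metric_space "carr (dual X)" "ndist (dual X)"
    using normed_dual by (rule normed_space.Metric_space_ndist)
  have "closedin M.mtopology (annihilator X A)"
    unfolding M.closedin_metric
  proof (intro conjI allI impI)
    show "annihilator X A \<subseteq> carr (dual X)" by (auto simp: annihilator_def)
    fix f assume f: "f \<in> carr (dual X) - annihilator X A"
    then obtain x where x: "x \<in> A" "f x \<noteq> 0" by (auto simp: annihilator_def)
    then have xX: "x \<in> carr X" using A by blast
    \<comment> \<open>With this radius, \<open>e * vnorm X x\<close> stays below
      \<open>norm (f x)\<close>, also when x has seminorm 0.\<close>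
    define e where "e = norm (f x) / (vnorm X x + 1)"
    have nx: "0 < vnorm X x + 1" using norm_nonneg[OF xX] by linarith
    have "e > 0" using x nx by (simp add: e_def)
    moreover have "g \<notin> annihilator X A" if g: "g \<in> M.mball f e" for g
    proof
      assume "g \<in> annihilator X A"
      then have gx: "g x = 0" and gX: "g \<in> carr (dual X)" using x by (auto dest: annihilatorD)
      let ?d = "vadd (dual X) f (vscale (dual X) (- 1) g)"
      have d: "?d \<in> carr (dual X)" using f gX by simp
      have "vnorm (dual X) ?d < e" using g f gX by (auto simp: ndist_def)
      then have "vnorm (dual X) ?d * vnorm X x \<le> e * vnorm X x"
        using norm_nonneg[OF xX] by (intro mult_right_mono) auto
      moreover have "norm (f x) \<le> vnorm (dual X) ?d * vnorm X x"
        using norm_le_dual_norm[OF d xX] gx xX by simp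
      moreover have "norm (f x) = e * (vnorm X x + 1)" using nx by (simp add: e_def)
      ultimately show False using \<open>e > 0\<close> by (simp add: distrib_left)
    qed
    ultimately show "\<exists>r>0. disjnt (annihilator X A) (M.mball f r)"
      by (auto simp: disjnt_iff)
  qed
  then show ?thesis
    using lin_subspace_annihilator[OF A] by (simp add: lin_subspace_def closed_subspace_def)
qed

lemma (in seminormed_space) canon_mem_annihilator:
  assumes "A \<subseteq> carr X" "x \<in> A"
  shows "canon X x \<in> annihilator (dual X) (annihilator X A)"
proof (rule annihilatorI)
  show "canon X x \<in> carr (bidual X)"
    by (rule bounded_opD(1)[OF bounded_op_canon[OF seminormed_space_axioms]]) (use assms in blast)
  show "canon X x f = 0" if "f \<in> annihilator X A" for f
    using annihilatorD[OF that] assms(2) by simp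
qed

subsection \<open>Tauberian operators and annihilators\<close>

text \<open>
  Here \<open>i\<close> is an isomorphism from \<open>X\<close> onto \<open>N\<^sup>\<bottom>\<close>, and \<open>q\<close> exhibits \<open>Y\<close> as \<open>Z\<^sup>*/M\<^sup>\<bottom>\<close>; the assumption
  \<open>factor\<close> replaces openness of \<open>q\<close>.
\<close>

lemma tauberian_iff:
  fixes Z :: "('k::rc_field, 'a) nspace" and X :: "('k, 'b) nspace" and Y :: "('k, 'c) nspace"
  assumes Z: "seminormed_space Z" and X: "seminormed_space X" and Y: "seminormed_space Y"
    and M: "M \<subseteq> carr Z" and N: "N \<subseteq> carr Z"
    and i: "bounded_op X (dual Z) i" and range_i: "i ` carr X = annihilator Z N"
    and C: "0 \<le> C" "\<And>x. x \<in> carr X \<Longrightarrow> vnorm X x \<le> C * vnorm (dual Z) (i x)"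
    and q: "bounded_op (dual Z) Y q" and onto: "q ` carr (dual Z) = carr Y"
    and ker: "\<And>v. v \<in> annihilator Z M \<Longrightarrow> q v = vzero Y"
    and factor: "\<And>\<psi>. \<psi> \<in> annihilator (dual Z) (annihilator Z M) \<Longrightarrow>
          \<exists>h\<in>carr (dual Y). \<forall>v\<in>carr (dual Z). h (q v) = \<psi> v"
    and S: "\<And>x. x \<in> carr X \<Longrightarrow> S x = q (i x)"
  shows "tauberian X Y S \<longleftrightarrow>
    annihilator (bidual Z) (canon_image Z \<union> annihilator (dual Z) (annihilator Z M)
      \<union> annihilator (dual Z) (annihilator Z N)) \<subseteq> {vzero (dual (bidual Z))}"
    (is "_ \<longleftrightarrow> annihilator _ (_ \<union> ?M \<union> ?N) \<subseteq> _")
proof -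
  interpret Z: seminormed_space Z by fact
  interpret X: seminormed_space X by fact
  interpret Y: seminormed_space Y by fact
  interpret Z': seminormed_space "dual Z" by (rule Z.seminormed_dual)
  interpret X': seminormed_space "dual X" by (rule X.seminormed_dual)
  interpret Y': seminormed_space "dual Y" by (rule Y.seminormed_dual)
  interpret Z'': seminormed_space "bidual Z" by (rule Z'.seminormed_dual)
  interpret Y'': seminormed_space "bidual Y" by (rule Y'.seminormed_dual)
  have bS: "bounded_op X Y S"
    by (rule bounded_op_comp[OF i q X Z.seminormed_dual]) (rule S)
  note S' = bounded_op_conj_op[OF bS X Y]
  note i' = bounded_op_conj_op[OF i X Z.seminormed_dual]
  note i'_closed = bounded_opD(1)[OF i'] and S'_closed = bounded_opD(1)[OF S']
  note S''_closed = conj_op_closed[OF S' Y.seminormed_dual X.seminormed_dual]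
  note canon = bounded_op_canon[OF Z]
  have i_mem: "i x \<in> annihilator Z N" if "x \<in> carr X" for x
    using range_i that by blast
  have canon_M: "canon Z z \<in> ?M" if "z \<in> M" for z
    using Z.canon_mem_annihilator[OF M that] .
  have canon_N: "canon Z z \<in> ?N" if "z \<in> N" for z
    using Z.canon_mem_annihilator[OF N that] .
  \<comment> \<open>Every g on X has a norm-controlled extension along i to an element of
    \<open>Z\<^sup>*\<^sup>*\<close>. The selection E of such extensions need not be linear.\<close>
  have "\<exists>\<psi>. \<psi> \<in> carr (bidual Z) \<and> (\<forall>x\<in>carr X. \<psi> (i x) = g x) \<and>
      vnorm (bidual Z) \<psi> \<le> C * vnorm (dual X) g" if g: "g \<in> carr (dual X)" for g
    by (rule extend_along[OF X Z.seminormed_dual i C g]) auto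
  then obtain E where E: "\<And>g. g \<in> carr (dual X) \<Longrightarrow> E g \<in> carr (bidual Z)"
    "\<And>g x. g \<in> carr (dual X) \<Longrightarrow> x \<in> carr X \<Longrightarrow> E g (i x) = g x"
    "\<And>g. g \<in> carr (dual X) \<Longrightarrow> vnorm (bidual Z) (E g) \<le> C * vnorm (dual X) g"
    by metis
  show ?thesis
  proof
    assume T: "tauberian X Y S"
    show "annihilator (bidual Z) (canon_image Z \<union> ?M \<union> ?N) \<subseteq> {vzero (dual (bidual Z))}"
    proof
      fix F assume "F \<in> annihilator (bidual Z) (canon_image Z \<union> ?M \<union> ?N)"
      note F = annihilatorD[OF this]
      \<comment> \<open>F read on \<open>X\<^sup>*\<close>. Because F kills
        \<open>N\<^sup>\<bottom>\<^sup>\<bottom>\<close>, its value at \<open>\<psi>\<close> depends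
        only on \<open>\<psi> \<circ> i\<close>; this is \<open>key\<close>, from which the
        linearity of \<open>\<phi>\<close> follows although E is arbitrary.\<close>
      define \<phi> where "\<phi> = (\<lambda>g\<in>carr (dual X). F (E g))"
      have key: "\<phi> g = F \<psi>"
        if g: "g \<in> carr (dual X)" and \<psi>: "\<psi> \<in> carr (bidual Z)" "\<And>x. x \<in> carr X \<Longrightarrow> \<psi> (i x) = g x"
        for g \<psi>
      proof -
        let ?d = "vadd (bidual Z) \<psi> (vscale (bidual Z) (- 1) (E g))"
        have "?d \<in> ?N"
        proof (rule annihilatorI)
          show "?d \<in> carr (bidual Z)" using \<psi>(1) E(1)[OF g] by simp
          fix v assume "v \<in> annihilator Z N"
          then obtain x where "x \<in> carr X" "v = i x" using range_i by blast
          then show "?d v = 0" using \<psi>(2) E(2)[OF g] bounded_opD(1)[OF i] by simp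
        qed
        then have "F ?d = 0" using F(2) by blast
        then show ?thesis
          using g \<psi>(1) E(1)[OF g] by (simp add: \<phi>_def dualD(2,3)[OF F(1)])
      qed
      have "\<phi> \<in> carr (bidual X)"
      proof (rule dualI)
        show "\<phi> \<in> extensional (carr (dual X))"
          unfolding \<phi>_def by (rule restrict_extensional)
        show "\<phi> (vadd (dual X) g h) = \<phi> g + \<phi> h"
          if "g \<in> carr (dual X)" "h \<in> carr (dual X)" for g h
        proof -
          have "\<phi> (vadd (dual X) g h) = F (vadd (bidual Z) (E g) (E h))"
            by (rule key) (use that E bounded_opD(1)[OF i] in simp_all)
          then show ?thesis using that E(1) by (simp add: \<phi>_def dualD(2)[OF F(1)])
        qed
        show "\<phi> (vscale (dual X) c g) = c * \<phi> g" if "g \<in> carr (dual X)" for c g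
        proof -
          have "\<phi> (vscale (dual X) c g) = F (vscale (bidual Z) c (E g))"
            by (rule key) (use that E bounded_opD(1)[OF i] in simp_all)
          then show ?thesis using that E(1) by (simp add: \<phi>_def dualD(3)[OF F(1)])
        qed
        show "norm (\<phi> g) \<le> (vnorm (dual (bidual Z)) F * C) * vnorm (dual X) g"
          if "g \<in> carr (dual X)" for g
        proof -
          have "norm (\<phi> g) \<le> vnorm (dual (bidual Z)) F * vnorm (bidual Z) (E g)"
            using Z''.norm_le_dual_norm[OF F(1) E(1)[OF that]] that by (simp add: \<phi>_def)
          also have "\<dots> \<le> vnorm (dual (bidual Z)) F * (C * vnorm (dual X) g)"
            by (intro mult_left_mono E(3) that Z''.dual_norm_nonneg F(1))
          finally show ?thesis by (simp add: mult.assoc)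
        qed
      qed
      note \<phi> = this
      let ?S\<phi> = "conj_op (dual Y) (conj_op X S) \<phi>"
      \<comment> \<open>For h in \<open>Y\<^sup>*\<close> the functional \<open>h \<circ> q\<close>
        lies in \<open>M\<^sup>\<bottom>\<^sup>\<bottom>\<close>, where F vanishes. So the second
        conjugate of S sends \<open>\<phi>\<close> to 0, a point of Y, and S being tauberian puts
        \<open>\<phi>\<close> into X.\<close>
      have "?S\<phi> = canon Y (vzero Y)"
      proof (rule dual_eqI[OF S''_closed[OF \<phi>] bounded_opD(1)[OF bounded_op_canon[OF Y]]])
        fix h assume h: "h \<in> carr (dual Y)"
        let ?\<psi> = "conj_op (dual Z) q h"
        have \<psi>: "?\<psi> \<in> carr (bidual Z)"
          by (rule conj_op_closed[OF q Z.seminormed_dual Y h])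
        have "?\<psi> \<in> ?M"
          by (rule annihilatorI[OF \<psi>]) (simp add: annihilatorD(1) ker Y.dual_zero[OF h])
        then have "F ?\<psi> = 0" using F(2) by blast
        moreover have "\<phi> (conj_op X S h) = F ?\<psi>"
          by (rule key[OF S'_closed[OF h] \<psi>]) (simp add: S bounded_opD(1)[OF i])
        ultimately show "?S\<phi> h = canon Y (vzero Y) h"
          using h by (simp add: Y.dual_zero)
      qed simp
      then have "?S\<phi> \<in> canon_image Y"
        unfolding canon_image_def by blast
      then have "\<phi> \<in> canon_image X"
        using T \<phi> unfolding tauberian_def by blast
      then obtain x where x: "x \<in> carr X" "\<phi> = canon X x"
        by (auto simp: canon_image_def)
      \<comment> \<open>As \<open>\<phi>\<close> is a point x of X, F is evaluation at
        \<open>i x\<close>. Since F annihilates Z, the functional \<open>i x\<close> vanishes on Z,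
        and F is 0.\<close>
      have F_eq: "F \<psi> = \<psi> (i x)" if \<psi>: "\<psi> \<in> carr (bidual Z)" for \<psi>
        using key[OF i'_closed[OF \<psi>] \<psi>] x i'_closed[OF \<psi>] by simp
      have "i x = vzero (dual Z)"
      proof (rule dual_eqI[OF bounded_opD(1)[OF i x(1)] Z.zero_dual])
        fix z assume z: "z \<in> carr Z"
        have "F (canon Z z) = 0" using F(2) z by (auto simp: canon_image_def)
        then show "i x z = vzero (dual Z) z"
          using F_eq[OF bounded_opD(1)[OF canon z]] bounded_opD(1)[OF i x(1)] z by simp
      qed
      then have "F = vzero (dual (bidual Z))"
        using F_eq Z'.dual_zero by (intro dual_eqI[OF F(1) Z''.zero_dual]) simp
      then show "F \<in> {vzero (dual (bidual Z))}" by simp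
    qed
  next
    assume ann: "annihilator (bidual Z) (canon_image Z \<union> ?M \<union> ?N) \<subseteq> {vzero (dual (bidual Z))}"
    have "\<phi> \<in> canon_image X"
      if \<phi>: "\<phi> \<in> carr (bidual X)" and im: "conj_op (dual Y) (conj_op X S) \<phi> \<in> canon_image Y" for \<phi>
    proof -
      obtain y where y: "y \<in> carr Y" "conj_op (dual Y) (conj_op X S) \<phi> = canon Y y"
        using im by (auto simp: canon_image_def)
      obtain v where v: "v \<in> carr (dual Z)" "y = q v"
        using y onto by blast
      \<comment> \<open>The second conjugate of i carries \<open>\<phi>\<close> to the third dual of
        Z.\<close>
      define F where "F = conj_op (bidual Z) (conj_op X i) \<phi>"
      have F: "F \<in> carr (dual (bidual Z))"
        unfolding F_def
        by (rule conj_op_closed[OF i' Z'.seminormed_dual X.seminormed_dual \<phi>])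
      have F_apply: "F \<psi> = \<phi> (conj_op X i \<psi>)" if "\<psi> \<in> carr (bidual Z)" for \<psi>
        using that by (simp add: F_def)
      have F_N: "F \<psi> = 0" if "\<psi> \<in> ?N" for \<psi>
      proof -
        note \<psi> = annihilatorD[OF that]
        have "conj_op X i \<psi> = vzero (dual X)"
          by (rule dual_eqI[OF i'_closed[OF \<psi>(1)] X.zero_dual]) (simp add: \<psi>(2) i_mem)
        then show ?thesis using F_apply[OF \<psi>(1)] X'.dual_zero[OF \<phi>] by simp
      qed
      \<comment> \<open>\<open>factor\<close> writes \<open>\<psi>\<close> as
        \<open>h \<circ> q\<close>. Then the conjugate of i at \<open>\<psi>\<close> is the
        conjugate of S at h, and \<open>\<phi>\<close> takes there the value
        \<open>h y = h (q v)\<close>.\<close>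
      have F_M: "F \<psi> = \<psi> v" if \<psi>M: "\<psi> \<in> ?M" for \<psi>
      proof -
        note \<psi> = annihilatorD[OF \<psi>M]
        obtain h where h: "h \<in> carr (dual Y)" "\<And>v. v \<in> carr (dual Z) \<Longrightarrow> h (q v) = \<psi> v"
          using factor[OF \<psi>M] by blast
        have "conj_op X i \<psi> = conj_op X S h"
          by (rule dual_eqI[OF i'_closed[OF \<psi>(1)] S'_closed[OF h(1)]])
            (simp add: S h(2) bounded_opD(1)[OF i])
        then have "F \<psi> = canon Y y h"
          using F_apply[OF \<psi>(1)] h(1) by (simp flip: y(2))
        then show ?thesis using h v by simp
      qed
      \<comment> \<open>The restriction of F to Z. It annihilates N because F vanishes on
        \<open>N\<^sup>\<bottom>\<^sup>\<bottom>\<close>, which contains the canonical image of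
        N.\<close>
      define f where "f = conj_op Z (canon Z) F"
      have f: "f \<in> carr (dual Z)"
        unfolding f_def by (rule conj_op_closed[OF canon Z Z'.seminormed_dual F])
      have f_apply: "f z = F (canon Z z)" if "z \<in> carr Z" for z
        using that by (simp add: f_def)
      have f_N: "f \<in> annihilator Z N"
        using f N F_N canon_N by (intro annihilatorI) (auto simp: f_apply)
      then obtain x where x: "x \<in> carr X" "f = i x"
        using range_i by blast
      \<comment> \<open>On M both v and f are values of F, so they differ by an element of
        \<open>M\<^sup>\<bottom>\<close>, and elements of
        \<open>M\<^sup>\<bottom>\<^sup>\<bottom>\<close> do not distinguish them.\<close>
      have vf: "vadd (dual Z) v (vscale (dual Z) (- 1) f) \<in> annihilator Z M"
      proof (rule annihilatorI)
        show "vadd (dual Z) v (vscale (dual Z) (- 1) f) \<in> carr (dual Z)"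
          using v f by simp
        fix m assume m: "m \<in> M"
        then have "f m = v m"
          using f_apply[of m] F_M[OF canon_M] M v by auto
        then show "vadd (dual Z) v (vscale (dual Z) (- 1) f) m = 0"
          using m M by (auto simp: subset_iff)
      qed
      define cf where "cf = canon (dual Z) f"
      have cf: "cf \<in> carr (dual (bidual Z))"
        unfolding cf_def by (rule bounded_opD(1)[OF bounded_op_canon[OF Z.seminormed_dual] f])
      \<comment> \<open>F minus evaluation at f. It vanishes on Z by the choice of f, on
        \<open>M\<^sup>\<bottom>\<^sup>\<bottom>\<close> by \<open>F_M\<close> and
        \<open>vf\<close>, and on \<open>N\<^sup>\<bottom>\<^sup>\<bottom>\<close> because f lies in
        \<open>N\<^sup>\<bottom>\<close>.\<close>
      let ?G = "vadd (dual (bidual Z)) F (vscale (dual (bidual Z)) (- 1) cf)"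
      have G: "?G \<psi> = F \<psi> - \<psi> f" if "\<psi> \<in> carr (bidual Z)" for \<psi>
        using that by (simp add: cf_def)
      have "?G \<in> annihilator (bidual Z) (canon_image Z \<union> ?M \<union> ?N)"
      proof (rule annihilatorI)
        show "?G \<in> carr (dual (bidual Z))"
          using F cf by (intro Z''.add_dual Z''.scale_dual)
        fix \<psi> assume "\<psi> \<in> canon_image Z \<union> ?M \<union> ?N"
        then consider z where "z \<in> carr Z" "\<psi> = canon Z z" | "\<psi> \<in> ?M" | "\<psi> \<in> ?N"
          by (auto simp: canon_image_def)
        then show "?G \<psi> = 0"
        proof cases
          case 1
          then show ?thesis
            using G[OF bounded_opD(1)[OF canon]] f f_apply by simp
        next
          case 2
          note \<psi> = annihilatorD[OF 2]
          have "\<psi> v - \<psi> f = 0"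
            using \<psi>(2)[OF vf] v f by (simp add: dualD(2,3)[OF \<psi>(1)])
          then show ?thesis using G[OF \<psi>(1)] F_M[OF 2] by simp
        next
          case 3
          note \<psi> = annihilatorD[OF 3]
          show ?thesis using G[OF \<psi>(1)] F_N[OF 3] \<psi>(2)[OF f_N] by simp
        qed
      qed
      then have "?G = vzero (dual (bidual Z))" using ann by blast
      then have F_eq: "F \<psi> = \<psi> f" if "\<psi> \<in> carr (bidual Z)" for \<psi>
        using G[OF that] that by simp
      \<comment> \<open>F is evaluation at \<open>f = i x\<close>; testing on the extensions
        \<open>E g\<close> brings this back to X.\<close>
      have "\<phi> = canon X x"
      proof (rule dual_eqI[OF \<phi> bounded_opD(1)[OF bounded_op_canon[OF X] x(1)]])
        fix g assume g: "g \<in> carr (dual X)"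
        have "conj_op X i (E g) = g"
          by (rule dual_eqI[OF i'_closed[OF E(1)[OF g]] g]) (simp add: E(2)[OF g])
        then have "\<phi> g = E g f"
          using F_apply[OF E(1)[OF g]] F_eq[OF E(1)[OF g]] by simp
        then show "\<phi> g = canon X x g"
          using E(2)[OF g x(1)] x(2) g by simp
      qed
      then show ?thesis using x(1) unfolding canon_image_def by blast
    qed
    then show "tauberian X Y S"
      unfolding tauberian_def using bS S''_closed by blast
  qed
qed

section \<open>Tauberian and cotauberian pairs\<close>

lemma (in seminormed_space) bounded_op_subsp:
  assumes "A \<subseteq> carr X"
  shows "bounded_op (subsp X A) X (\<lambda>x. x)"
  using assms by (intro bounded_opI[of _ _ _ 1]) auto

lemma (in seminormed_quotient) bounded_op_pair_op:
  assumes B: "lin_subspace V B"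
  shows "bounded_op (subsp V B) (quot_space V A) (pair_op V B A)"
  by (rule bounded_op_comp[OF bounded_op_subsp bounded_op_qmap])
    (use lin_subspaceD(1)[OF B] seminormed_subsp[OF B] seminormed_space_axioms
      in \<open>simp_all add: pair_op_def incl_def\<close>)

text \<open>The direct case of \<open>tauberian_iff\<close>: i is the inclusion of
  \<open>N\<^sup>\<bottom>\<close>, q is the quotient map modulo \<open>M\<^sup>\<bottom>\<close>,
  and C is 1. The assumption \<open>factor\<close> is \<open>factor_qmap\<close>.\<close>

lemma W_plus_annihilators_iff:
  fixes Z :: "('k::rc_field, 'a) nspace"
  assumes Z: "seminormed_space Z" and M: "M \<subseteq> carr Z" and N: "N \<subseteq> carr Z"
  shows "(annihilator Z N, annihilator Z M) \<in> W_plus (dual Z) \<longleftrightarrow>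
    annihilator (bidual Z) (canon_image Z \<union> annihilator (dual Z) (annihilator Z M)
      \<union> annihilator (dual Z) (annihilator Z N)) \<subseteq> {vzero (dual (bidual Z))}"
proof -
  interpret Z: seminormed_space Z by fact
  note N' = Z.lin_subspace_annihilator[OF N]
  interpret Q: seminormed_quotient "dual Z" "annihilator Z M"
    using Z.seminormed_dual Z.lin_subspace_annihilator[OF M]
    by (intro seminormed_quotient.intro seminormed_quotient_axioms.intro)
  have "(annihilator Z N, annihilator Z M) \<in> W_plus (dual Z) \<longleftrightarrow>
      tauberian (subsp (dual Z) (annihilator Z N)) (quot_space (dual Z) (annihilator Z M))
        (pair_op (dual Z) (annihilator Z N) (annihilator Z M))"
    using Z.closed_subspace_annihilator M N by (simp add: W_plus_def)
  also have "\<dots> \<longleftrightarrow> annihilator (bidual Z) (canon_image Z \<union> annihilator (dual Z) (annihilator Z M)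
      \<union> annihilator (dual Z) (annihilator Z N)) \<subseteq> {vzero (dual (bidual Z))}"
  proof (rule tauberian_iff[OF Z Q.seminormed_subsp[OF N'] Q.seminormed_quot M N
        Q.bounded_op_subsp[OF lin_subspaceD(1)[OF N']] _ _ _ Q.bounded_op_qmap, of 1])
    fix \<psi> assume "\<psi> \<in> annihilator (dual Z) (annihilator Z M)"
    then show "\<exists>h\<in>carr (dual (quot_space (dual Z) (annihilator Z M))).
        \<forall>v\<in>carr (dual Z). h (qmap (dual Z) (annihilator Z M) v) = \<psi> v"
      by (rule Q.factor_qmap) blast
  qed (simp_all add: Q.qmap_of_mem pair_op_def incl_def)
  finally show ?thesis .
qed

text \<open>The conjugate runs from the dual of Z/N to the dual of M. In
  \<open>tauberian_iff\<close>, i becomes the conjugate of the quotient map, an isometry onto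
  \<open>N\<^sup>\<bottom>\<close>, and q the restriction of functionals to M.\<close>

lemma W_minus_iff:
  fixes Z :: "('k::rc_field, 'a) nspace"
  assumes Z: "seminormed_space Z" and M: "closed_subspace Z M" and N: "closed_subspace Z N"
  shows "(M, N) \<in> W_minus Z \<longleftrightarrow>
    annihilator (bidual Z) (canon_image Z \<union> annihilator (dual Z) (annihilator Z M)
      \<union> annihilator (dual Z) (annihilator Z N)) \<subseteq> {vzero (dual (bidual Z))}"
proof -
  interpret Z: seminormed_space Z by fact
  note lM = closed_subspace_imp_lin_subspace[OF M] and lN = closed_subspace_imp_lin_subspace[OF N]
  note MZ = lin_subspaceD(1)[OF lM] and NZ = lin_subspaceD(1)[OF lN]
  interpret Q: seminormed_quotient Z N
    using Z lN by (intro seminormed_quotient.intro seminormed_quotient_axioms.intro)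
  let ?Q = "quot_space Z N" and ?M = "subsp Z M"
  interpret Q': seminormed_space ?Q by (rule Q.seminormed_quot)
  interpret M: seminormed_space ?M by (rule Z.seminormed_subsp[OF lM])
  interpret Z': seminormed_space "dual Z" by (rule Z.seminormed_dual)
  interpret M': seminormed_space "dual ?M" by (rule M.seminormed_dual)
  let ?i = "conj_op Z (qmap Z N)" and ?q = "conj_op ?M (\<lambda>x. x)"
  note q = bounded_op_conj_op[OF Z.bounded_op_subsp[OF MZ] M.seminormed_space_axioms Z]
  note i = bounded_op_conj_op[OF Q.bounded_op_qmap Z Q.seminormed_quot]
  have i_mem: "?i g \<in> annihilator Z N" if g: "g \<in> carr (dual ?Q)" for g
  proof (rule annihilatorI[OF bounded_opD(1)[OF i g]])
    show "?i g n = 0" if "n \<in> N" for n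
      using that Q'.dual_zero[OF g] by (simp add: Q.qmap_of_mem)
  qed
  have range_i: "?i ` carr (dual ?Q) = annihilator Z N"
  proof (intro equalityI subsetI)
    fix f assume f: "f \<in> annihilator Z N"
    obtain g where g: "g \<in> carr (dual ?Q)" "\<And>x. x \<in> carr Z \<Longrightarrow> g (qmap Z N x) = f x"
      by (rule Q.factor_qmap[OF f]) blast
    have "f = ?i g"
      by (rule dual_eqI[OF annihilatorD(1)[OF f] bounded_opD(1)[OF i g(1)]]) (simp add: g(2))
    then show "f \<in> ?i ` carr (dual ?Q)" using g(1) by blast
  qed (use i_mem in blast)
  have norm_i: "vnorm (dual ?Q) g \<le> 1 * vnorm (dual Z) (?i g)" if g: "g \<in> carr (dual ?Q)" for g
  proof -
    obtain h where h: "h \<in> carr (dual ?Q)" "\<And>x. x \<in> carr Z \<Longrightarrow> h (qmap Z N x) = ?i g x"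
      "vnorm (dual ?Q) h \<le> vnorm (dual Z) (?i g)"
      by (rule Q.factor_qmap[OF i_mem[OF g]]) blast
    \<comment> \<open>A functional on Z/N is determined by its values at cosets, so the
      norm-controlled factor of \<open>?i g\<close> is g itself.\<close>
    have "h = g"
      by (rule dual_eqI[OF h(1) g]) (use h(2) in auto)
    then show ?thesis using h(3) by simp
  qed
  \<comment> \<open>Hahn-Banach extensions from M to Z, without increase of norm, show that
    restriction to M is onto.\<close>
  have "\<exists>f. f \<in> carr (dual Z) \<and> (\<forall>x\<in>M. f x = y x) \<and> vnorm (dual Z) f \<le> 1 * vnorm (dual ?M) y"
    if y: "y \<in> carr (dual ?M)" for y
    by (rule extend_along[OF M.seminormed_space_axioms Z Z.bounded_op_subsp[OF MZ] _ _ y, of 1]) auto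
  then obtain E where E: "\<And>y. y \<in> carr (dual ?M) \<Longrightarrow> E y \<in> carr (dual Z)"
    "\<And>y x. y \<in> carr (dual ?M) \<Longrightarrow> x \<in> M \<Longrightarrow> E y x = y x"
    "\<And>y. y \<in> carr (dual ?M) \<Longrightarrow> vnorm (dual Z) (E y) \<le> 1 * vnorm (dual ?M) y"
    by metis
  have qE: "?q (E y) = y" if y: "y \<in> carr (dual ?M)" for y
    by (rule dual_eqI[OF bounded_opD(1)[OF q E(1)[OF y]] y]) (simp add: E(2)[OF y])
  have factor: "\<exists>h\<in>carr (dual (dual ?M)). \<forall>v\<in>carr (dual Z). h (?q v) = \<psi> v"
    if \<psi>ann: "\<psi> \<in> annihilator (dual Z) (annihilator Z M)" for \<psi>
  proof -
    note \<psi> = annihilatorD[OF \<psi>ann]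
    \<comment> \<open>Since \<open>\<psi>\<close> kills \<open>M\<^sup>\<bottom>\<close>,
      \<open>h y\<close> is the value of \<open>\<psi>\<close> at any extension of y. Sums and
      multiples of chosen extensions are extensions again, which makes h linear.\<close>
    define h where "h = (\<lambda>y\<in>carr (dual ?M). \<psi> (E y))"
    have h: "h y = \<psi> v" if v: "v \<in> carr (dual Z)" and y: "y \<in> carr (dual ?M)" and yv: "y = ?q v" for y v
    proof -
      let ?d = "vadd (dual Z) v (vscale (dual Z) (- 1) (E y))"
      have "?d \<in> annihilator Z M"
      proof (rule annihilatorI)
        show "?d \<in> carr (dual Z)" using v E(1)[OF y] by simp
        show "?d x = 0" if x: "x \<in> M" for x
          using x E(2)[OF y x] MZ yv by auto
      qed
      then have "\<psi> ?d = 0" by (rule \<psi>(2))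
      then show ?thesis
        using v y E(1)[OF y] by (simp add: h_def dualD(2,3)[OF \<psi>(1)])
    qed
    have "h \<in> carr (dual (dual ?M))"
    proof (rule dualI)
      show "h \<in> extensional (carr (dual ?M))"
        unfolding h_def by (rule restrict_extensional)
      show "h (vadd (dual ?M) y z) = h y + h z"
        if yz: "y \<in> carr (dual ?M)" "z \<in> carr (dual ?M)" for y z
      proof -
        have "h (vadd (dual ?M) y z) = \<psi> (vadd (dual Z) (E y) (E z))"
          by (rule h) (simp_all add: yz E(1) qE bounded_opD(2)[OF q])
        then show ?thesis using yz E(1) by (simp add: h_def dualD(2)[OF \<psi>(1)])
      qed
      show "h (vscale (dual ?M) c y) = c * h y" if y: "y \<in> carr (dual ?M)" for c y
      proof -
        have "h (vscale (dual ?M) c y) = \<psi> (vscale (dual Z) c (E y))"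
          by (rule h) (simp_all add: y E(1) qE bounded_opD(3)[OF q])
        then show ?thesis using y E(1) by (simp add: h_def dualD(3)[OF \<psi>(1)])
      qed
      show "norm (h y) \<le> vnorm (bidual Z) \<psi> * vnorm (dual ?M) y" if y: "y \<in> carr (dual ?M)" for y
      proof -
        have "norm (h y) \<le> vnorm (bidual Z) \<psi> * vnorm (dual Z) (E y)"
          using Z'.norm_le_dual_norm[OF \<psi>(1) E(1)[OF y]] y by (simp add: h_def)
        also have "\<dots> \<le> vnorm (bidual Z) \<psi> * vnorm (dual ?M) y"
          using E(3)[OF y] by (intro mult_left_mono Z'.dual_norm_nonneg \<psi>(1)) simp
        finally show ?thesis .
      qed
    qed
    moreover have "h (?q v) = \<psi> v" if v: "v \<in> carr (dual Z)" for v
      by (rule h[OF v bounded_opD(1)[OF q v] refl])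
    ultimately show ?thesis by blast
  qed
  have "(M, N) \<in> W_minus Z \<longleftrightarrow>
      tauberian (dual ?Q) (dual ?M) (conj_op ?M (pair_op Z M N))"
    using M N Q.bounded_op_pair_op[OF lM] by (simp add: W_minus_def cotauberian_def)
  also have "\<dots> \<longleftrightarrow> annihilator (bidual Z) (canon_image Z \<union> annihilator (dual Z) (annihilator Z M)
      \<union> annihilator (dual Z) (annihilator Z N)) \<subseteq> {vzero (dual (bidual Z))}"
  proof (rule tauberian_iff[OF Z Q'.seminormed_dual M.seminormed_dual MZ NZ i range_i _ norm_i q])
    show "?q ` carr (dual Z) = carr (dual ?M)"
    proof (intro equalityI subsetI)
      show "y \<in> ?q ` carr (dual Z)" if y: "y \<in> carr (dual ?M)" for y
        using qE[OF y] E(1)[OF y] by (metis imageI)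
    qed (use bounded_opD(1)[OF q] in blast)
    show "?q v = vzero (dual ?M)" if v: "v \<in> annihilator Z M" for v
      by (rule dual_eqI[OF bounded_opD(1)[OF q annihilatorD(1)[OF v]] M.zero_dual])
        (simp add: annihilatorD(2)[OF v])
    show "conj_op ?M (pair_op Z M N) g = ?q (?i g)" for g
      unfolding conj_op_def using MZ by (auto simp: pair_op_def incl_def intro!: restrict_ext)
  qed (use factor in simp_all)
  finally show ?thesis .
qed

section \<open>Density in quotients and in the residuum space\<close>

lemma lin_subspace_image:
  assumes T: "bounded_op X Y T" and X: "seminormed_space X" and Y: "seminormed_space Y"
    and A: "lin_subspace X A"
  shows "lin_subspace Y (T ` A)"
proof -
  note [simp] = lin_subspaceD(2-)[OF A] bounded_opD[OF T]
  have "vzero Y \<in> T ` A"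
    using bounded_op_zero[OF T X Y] by (metis imageI lin_subspaceD(3)[OF A])
  moreover have "vadd Y (T x) (T y) \<in> T ` A" if "x \<in> A" "y \<in> A" for x y
    using that by (intro image_eqI[of _ _ "vadd X x y"]) auto
  moreover have "vscale Y c (T x) \<in> T ` A" if "x \<in> A" for c x
    using that by (intro image_eqI[of _ _ "vscale X c x"]) auto
  ultimately show ?thesis by (auto simp: lin_subspace_def)
qed

lemma (in seminormed_space) lin_subspace_set_add:
  assumes A: "lin_subspace X A" and B: "lin_subspace X B"
  shows "lin_subspace X (set_add X A B)"
proof -
  note [simp] = lin_subspaceD(2-)[OF A] lin_subspaceD(2-)[OF B]
  have I: "vadd X a b \<in> set_add X A B" if "a \<in> A" "b \<in> B" for a b
    using that by (auto simp: set_add_def)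
  show ?thesis
    unfolding lin_subspace_def
  proof (intro conjI ballI allI)
    show "set_add X A B \<subseteq> carr X" by (auto simp: set_add_def)
    show "vzero X \<in> set_add X A B" using I[of "vzero X" "vzero X"] by simp
    fix x assume "x \<in> set_add X A B"
    then obtain a b where x: "a \<in> A" "b \<in> B" "x = vadd X a b" by (auto simp: set_add_def)
    show "vscale X c x \<in> set_add X A B" for c
      using I[of "vscale X c a" "vscale X c b"] x by (simp add: scale_add_right)
    fix y assume "y \<in> set_add X A B"
    then obtain a' b' where y: "a' \<in> A" "b' \<in> B" "y = vadd X a' b'" by (auto simp: set_add_def)
    have "vadd X x y = vadd X (vadd X a a') (vadd X b b')"
      using x y by (simp add: add_ac)
    then show "vadd X x y \<in> set_add X A B"
      using I[of "vadd X a a'" "vadd X b b'"] x y by simp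
  qed
qed

text \<open>The component in A changes sides: the coset of \<open>x - b\<close> has norm below e iff
  x is within e of some \<open>b - a\<close> with a in A.\<close>

lemma (in seminormed_quotient) dense_in_quot_iff:
  assumes B: "lin_subspace V B"
  shows "dense_in (quot_space V A) (pair_op V B A ` B) \<longleftrightarrow> dense_in V (set_add V B A)"
proof -
  let ?Q = "quot_space V A"
  note [simp] = lin_subspaceD(2-)[OF B]
  have po: "pair_op V B A b = qmap V A b" if "b \<in> B" for b
    using that by (simp add: pair_op_def incl_def)
  have dist: "ndist ?Q (qmap V A x) (qmap V A b) = vnorm ?Q (qmap V A (vadd V x (vscale V (- 1) b)))"
    if "x \<in> carr V" "b \<in> B" for x b
    using that by (simp add: ndist_def vadd_quot vscale_quot)
  show ?thesis
  proof
    assume dense: "dense_in ?Q (pair_op V B A ` B)"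
    show "dense_in V (set_add V B A)"
      unfolding dense_in_def
    proof (intro conjI ballI allI impI)
      show "set_add V B A \<subseteq> carr V" by (auto simp: set_add_def)
      fix x e assume x: "x \<in> carr V" and e: "(0::real) < e"
      have "qmap V A x \<in> carr ?Q" using x by simp
      then obtain b where b: "b \<in> B" "ndist ?Q (qmap V A x) (pair_op V B A b) < e"
        using dense e unfolding dense_in_def by blast
      then have "vnorm ?Q (qmap V A (vadd V x (vscale V (- 1) b))) < e"
        using dist[OF x] by (simp add: po)
      then obtain a where a: "a \<in> A"
        "vnorm V (vadd V (vadd V x (vscale V (- 1) b)) a) < e"
        using x b by (auto elim: norm_quot_less[rotated])
      let ?d = "vadd V b (vscale V (- 1) a)"
      have "vadd V x (vscale V (- 1) ?d) = vadd V (vadd V x (vscale V (- 1) b)) a"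
        using x a b by (simp add: scale_add_right add_assoc)
      then have "ndist V x ?d < e"
        using x a b by (simp add: ndist_def)
      moreover have "?d \<in> set_add V B A" unfolding set_add_def using a(1) b(1) A_rules(4) by blast
      ultimately show "\<exists>d\<in>set_add V B A. ndist V x d < e" by blast
    qed
  next
    assume dense: "dense_in V (set_add V B A)"
    show "dense_in ?Q (pair_op V B A ` B)"
      unfolding dense_in_def
    proof (intro conjI ballI allI impI)
      show "pair_op V B A ` B \<subseteq> carr ?Q" by (auto simp: po)
      fix C e assume "C \<in> carr ?Q" and e: "(0::real) < e"
      then obtain x where x: "x \<in> carr V" "C = qmap V A x" by auto
      obtain d where "d \<in> set_add V B A" "ndist V x d < e"
        using dense x e unfolding dense_in_def by blast
      then obtain a b where d: "b \<in> B" "a \<in> A" "ndist V x (vadd V b a) < e"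
        by (auto simp: set_add_def)
      have "vnorm ?Q (qmap V A (vadd V x (vscale V (- 1) b)))
          \<le> vnorm V (vadd V (vadd V x (vscale V (- 1) b)) (vscale V (- 1) a))"
        using x d by (intro norm_quot_le) auto
      also have "vadd V (vadd V x (vscale V (- 1) b)) (vscale V (- 1) a)
          = vadd V x (vscale V (- 1) (vadd V b a))"
        using x d by (simp add: scale_add_right add_assoc)
      also have "vnorm V \<dots> < e"
        using d x by (simp add: ndist_def)
      finally show "\<exists>D\<in>pair_op V B A ` B. ndist ?Q C D < e"
        using d(1) dist[OF x(1) d(1)] x(2) po[OF d(1)] by (metis imageI)
    qed
  qed
qed

text \<open>Density is turned into a statement about annihilators. Through \<open>qmap\<close>,
  functionals on \<open>co_space Z\<close> are those on \<open>Z\<^sup>*\<^sup>*\<close> that vanish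
  on Z, and they annihilate \<open>co_sub Z M\<close> iff their pullbacks annihilate
  \<open>M\<^sup>\<bottom>\<^sup>\<bottom>\<close>. The first two conclusions prepare for
  \<open>dense_in_quot_iff\<close>.\<close>

lemma dense_in_co_space_iff:
  fixes Z :: "('k::rc_field, 'a) nspace"
  assumes Z: "seminormed_space Z" and M: "lin_subspace Z M" and N: "lin_subspace Z N"
  shows "seminormed_quotient (co_space Z) (co_sub Z N)"
    and "lin_subspace (co_space Z) (co_sub Z M)"
    and "dense_in (co_space Z) (set_add (co_space Z) (co_sub Z M) (co_sub Z N)) \<longleftrightarrow>
    annihilator (bidual Z) (canon_image Z \<union> annihilator (dual Z) (annihilator Z M)
      \<union> annihilator (dual Z) (annihilator Z N)) \<subseteq> {vzero (dual (bidual Z))}"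
    (is "_ \<longleftrightarrow> annihilator _ (_ \<union> ?M \<union> ?N) \<subseteq> _")
proof -
  interpret Z: seminormed_space Z by fact
  interpret Z': seminormed_space "dual Z" by (rule Z.seminormed_dual)
  interpret Z'': seminormed_space "bidual Z" by (rule Z'.seminormed_dual)
  have all: "lin_subspace Z (carr Z)" by (auto simp: lin_subspace_def)
  interpret Q: seminormed_quotient "bidual Z" "canon_image Z"
    unfolding canon_image_def
    using lin_subspace_image[OF bounded_op_canon[OF Z] Z Z'.seminormed_dual all] Z'.seminormed_dual
    by (intro seminormed_quotient.intro seminormed_quotient_axioms.intro)
  let ?q = "qmap (bidual Z) (canon_image Z)"
  interpret co: seminormed_space "co_space Z"
    unfolding co_space_def by (rule Q.seminormed_quot)
  have bidual_sub: "lin_subspace (bidual Z) (annihilator (dual Z) (annihilator Z A))"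
    if "lin_subspace Z A" for A
    using that by (intro Z'.lin_subspace_annihilator) (auto simp: annihilator_def)
  have co_sub: "lin_subspace (co_space Z) (co_sub Z A)" if "lin_subspace Z A" for A
    unfolding co_space_def co_sub_def
    by (rule lin_subspace_image[OF Q.bounded_op_qmap Z'.seminormed_dual Q.seminormed_quot])
      (intro Z''.lin_subspace_set_add bidual_sub that Q.A)
  show "lin_subspace (co_space Z) (co_sub Z M)" by (rule co_sub[OF M])
  show "seminormed_quotient (co_space Z) (co_sub Z N)"
    using co.seminormed_space_axioms co_sub[OF N]
    by (intro seminormed_quotient.intro seminormed_quotient_axioms.intro)
  have mem_co_sub: "?q \<psi> \<in> co_sub Z A" if "\<psi> \<in> annihilator (dual Z) (annihilator Z A)" for \<psi> A
  proof -
    have "\<psi> \<in> carr (bidual Z)" by (rule annihilatorD(1)[OF that])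
    then have "\<psi> = vadd (bidual Z) \<psi> (vzero (bidual Z))" by simp
    then have "\<psi> \<in> set_add (bidual Z) (annihilator (dual Z) (annihilator Z A)) (canon_image Z)"
      unfolding set_add_def using that Q.A_rules(2) by blast
    then show ?thesis unfolding co_sub_def by blast
  qed
  let ?D = "set_add (co_space Z) (co_sub Z M) (co_sub Z N)"
  have "dense_in (co_space Z) ?D \<longleftrightarrow> annihilator (co_space Z) ?D \<subseteq> {vzero (dual (co_space Z))}"
    by (intro dense_in_iff_annihilator co.seminormed_space_axioms co.lin_subspace_set_add co_sub M N)
  also have "\<dots> \<longleftrightarrow>
      annihilator (bidual Z) (canon_image Z \<union> ?M \<union> ?N) \<subseteq> {vzero (dual (bidual Z))}"
  proof (intro iffI subsetI)
    fix F assume ann: "annihilator (co_space Z) ?D \<subseteq> {vzero (dual (co_space Z))}"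
      and "F \<in> annihilator (bidual Z) (canon_image Z \<union> ?M \<union> ?N)"
    note F = annihilatorD[OF this(2)]
    have "F \<in> annihilator (bidual Z) (canon_image Z)"
      using F by (intro annihilatorI) auto
    then obtain g where g: "g \<in> carr (dual (co_space Z))"
      "\<And>\<psi>. \<psi> \<in> carr (bidual Z) \<Longrightarrow> g (?q \<psi>) = F \<psi>"
      unfolding co_space_def by (rule Q.factor_qmap) blast
    \<comment> \<open>Stated for a general A so as to serve for both M and N.\<close>
    have zero: "g C = 0" if C: "C \<in> co_sub Z A"
      and A: "annihilator (dual Z) (annihilator Z A) \<subseteq> canon_image Z \<union> ?M \<union> ?N" for C A
    proof -
      obtain \<psi> c where c: "\<psi> \<in> annihilator (dual Z) (annihilator Z A)" "c \<in> canon_image Z"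
        "C = ?q (vadd (bidual Z) \<psi> c)"
        using C unfolding co_sub_def set_add_def by blast
      have \<psi>: "\<psi> \<in> carr (bidual Z)" by (rule annihilatorD(1)[OF c(1)])
      have "F \<psi> = 0" "F c = 0" using F(2) c A by blast+
      then show ?thesis
        using g(2)[of "vadd (bidual Z) \<psi> c"] \<psi> c by (simp add: dualD(2)[OF F(1)])
    qed
    have "g \<in> annihilator (co_space Z) ?D"
    proof (rule annihilatorI[OF g(1)])
      fix C assume "C \<in> ?D"
      then obtain A B where AB: "A \<in> co_sub Z M" "B \<in> co_sub Z N" "C = vadd (co_space Z) A B"
        by (auto simp: set_add_def)
      have "A \<in> carr (co_space Z)" "B \<in> carr (co_space Z)"
        using AB lin_subspaceD(2)[OF co_sub] M N by blast+
      then show "g C = 0"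
        using zero[OF AB(1)] zero[OF AB(2)] AB(3) by (simp add: dualD(2)[OF g(1)] le_supI1 le_supI2)
    qed
    then have "g = vzero (dual (co_space Z))" using ann by blast
    then have "F \<psi> = 0" if "\<psi> \<in> carr (bidual Z)" for \<psi>
      using g(2)[OF that] that by (simp add: co_space_def)
    then show "F \<in> {vzero (dual (bidual Z))}"
      using dual_eqI[OF F(1) Z''.zero_dual] by simp
  next
    fix g assume ann: "annihilator (bidual Z) (canon_image Z \<union> ?M \<union> ?N) \<subseteq> {vzero (dual (bidual Z))}"
      and "g \<in> annihilator (co_space Z) ?D"
    note g = annihilatorD[OF this(2)]
    let ?F = "conj_op (bidual Z) ?q g"
    have F: "?F \<in> carr (dual (bidual Z))"
      using g(1) unfolding co_space_def
      by (rule conj_op_closed[OF Q.bounded_op_qmap Z'.seminormed_dual Q.seminormed_quot])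
    \<comment> \<open>Each summand contains 0, so annihilating the sum means annihilating both
      summands.\<close>
    have g0: "g C = 0" if C: "C \<in> co_sub Z M \<or> C \<in> co_sub Z N" for C
    proof -
      have "C \<in> carr (co_space Z)" using C lin_subspaceD(2)[OF co_sub] M N by blast
      then have "C = vadd (co_space Z) C (vzero (co_space Z))"
        "C = vadd (co_space Z) (vzero (co_space Z)) C" by simp_all
      then have "C \<in> ?D"
        using C lin_subspaceD(3)[OF co_sub[OF M]] lin_subspaceD(3)[OF co_sub[OF N]]
        unfolding set_add_def by blast
      then show ?thesis by (rule g(2))
    qed
    have "?F \<in> annihilator (bidual Z) (canon_image Z \<union> ?M \<union> ?N)"
    proof (rule annihilatorI[OF F])
      fix \<psi> assume "\<psi> \<in> canon_image Z \<union> ?M \<union> ?N"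
      then consider "\<psi> \<in> canon_image Z" | "\<psi> \<in> ?M \<or> \<psi> \<in> ?N" by blast
      then show "?F \<psi> = 0"
      proof cases
        case 1
        \<comment> \<open>The zero of the quotient is the coset \<open>canon_image Z\<close>
          itself.\<close>
        have "canon_image Z = vzero (co_space Z)" by (simp add: co_space_def)
        then show ?thesis
          using 1 Q.qmap_of_mem[OF 1] co.dual_zero[OF g(1)] by simp
      next
        case 2
        then have "g (?q \<psi>) = 0" using mem_co_sub by (intro g0) blast
        moreover have "\<psi> \<in> carr (bidual Z)" using 2 annihilatorD(1) by blast
        ultimately show ?thesis by simp
      qed
    qed
    then have F0: "?F = vzero (dual (bidual Z))" using ann by blast
    have "g C = vzero (dual (co_space Z)) C" if C: "C \<in> carr (co_space Z)" for C
    proof -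
      obtain \<psi> where \<psi>: "\<psi> \<in> carr (bidual Z)" "C = ?q \<psi>" using C by (auto simp: co_space_def)
      have "?F \<psi> = 0" unfolding F0 using \<psi>(1) by simp
      then show ?thesis using \<psi> C by simp
    qed
    then show "g \<in> {vzero (dual (co_space Z))}"
      using dual_eqI[OF g(1) co.zero_dual] by simp
  qed
  finally show "dense_in (co_space Z) ?D \<longleftrightarrow>
      annihilator (bidual Z) (canon_image Z \<union> ?M \<union> ?N) \<subseteq> {vzero (dual (bidual Z))}" .
qed

theorem proposition3p6:
  fixes Z :: "('k::rc_field, 'a) nspace" and M N :: "'a set"
  assumes "banach_space Z" and "closed_subspace Z M" and "closed_subspace Z N"
  shows "((M, N) \<in> W_minus Z \<longleftrightarrow> (annihilator Z N, annihilator Z M) \<in> W_plus (dual Z)) \<and>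
    ((annihilator Z N, annihilator Z M) \<in> W_plus (dual Z) \<longleftrightarrow>
       dense_in (quot_space (co_space Z) (co_sub Z N))
         (pair_op (co_space Z) (co_sub Z M) (co_sub Z N) ` co_sub Z M)) \<and>
    (dense_in (quot_space (co_space Z) (co_sub Z N))
         (pair_op (co_space Z) (co_sub Z M) (co_sub Z N) ` co_sub Z M) \<longleftrightarrow>
       dense_in (co_space Z) (set_add (co_space Z) (co_sub Z M) (co_sub Z N)))"
proof -
  have Z: "seminormed_space Z"
    using assms(1) by (simp add: banach_space_def normed_space.seminormed)
  have M: "lin_subspace Z M" and N: "lin_subspace Z N"
    using assms(2,3) by (simp_all add: closed_subspace_imp_lin_subspace)
  interpret seminormed_quotient "co_space Z" "co_sub Z N"
    by (rule dense_in_co_space_iff(1)[OF Z M N])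
  have "lin_subspace (co_space Z) (co_sub Z M)"
    by (rule dense_in_co_space_iff(2)[OF Z M N])
  \<comment> \<open>With \<open>co_space Z\<close> divided by \<open>co_sub Z N\<close>, this
    identifies the two forms of assertion (3); the other facts reduce all assertions to the same
    vanishing condition.\<close>
  from dense_in_quot_iff[OF this] show ?thesis
    using W_minus_iff[OF Z assms(2,3)]
      W_plus_annihilators_iff[OF Z lin_subspaceD(1)[OF M] lin_subspaceD(1)[OF N]]
      dense_in_co_space_iff(3)[OF Z M N]
    by simp
qed

end
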